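(* Let $n$ be an odd positive integer. Then there exist an open interval $I_{\frac{\pi}{4}}$ containing $\frac{\pi}{4}$ and an open interval $I_{\frac{3\pi}{4}}$ containing $\frac{3\pi}{4}$ such that, for every $\theta \in \left(I_{\frac{\pi}{4}} \cup I_{\frac{3\pi}{4}}\right) \setminus \{\frac{\pi}{4},\frac{3\pi}{4}\}$, the nodal set $N(\Phi^{\theta}_n)$ is a connected simple regular curve, and the eigenfunction $\Phi^{\theta}_n$ has exactly two nodal domains in $\mathbb{R}^2$.
   Context: $H_n$ denotes the (physicists') Hermite polynomial of degree $n$: $H_0(t)=1$, $H_1(t)=2t$, $H_n(t)=2tH_{n-1}(t)-2(n-1)H_{n-2}(t)$ for $n\ge 2$. For $\theta\in[0,\pi[$ and $(x,y)\in\mathbb{R}^2$, set $$\Phi^{\theta}_{n}(x,y) = \left( \cos\theta \, H_n(x) + \sin\theta \, H_n(y) \right)\exp\left(- \tfrac{x^2+y^2}{2}\right).$$ This is an eigenfunction of the harmonic oscillator $\widehat H=-\Delta+|x|^2$ on $L^2(\mathbb{R}^2)$ with eigenvalue $2(n+1)$. The nodal set $N(u)$ of an eigenfunction $u$ is the closure of its zero set $\{u=0\}$, and its nodal domains are the connected components of $\mathbb{R}^2\setminus N(u)$. *)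

theory Defs
  imports "HOL-Analysis.Analysis"
begin

(* The physicists' Hermite polynomials H_n. *)
fun hermite :: "nat \<Rightarrow> real \<Rightarrow> real" where
  "hermite 0 t = 1"
| "hermite (Suc 0) t = 2 * t"
| "hermite (Suc (Suc n)) t
     = 2 * t * hermite (Suc n) t - 2 * real (Suc n) * hermite n t"

definition Phi :: "nat \<Rightarrow> real \<Rightarrow> real \<times> real \<Rightarrow> real" where
  "Phi n \<theta> = (\<lambda>(x, y). (cos \<theta> * hermite n x + sin \<theta> * hermite n y)
                          * exp (- ((x\<^sup>2 + y\<^sup>2) / 2)))"

definition nodal_set :: "('a::topological_space \<Rightarrow> real) \<Rightarrow> 'a set" where
  "nodal_set u = closure {z. u z = 0}"

definition nodal_domains :: "('a::topological_space \<Rightarrow> real) \<Rightarrow> 'a set set" where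
  "nodal_domains u = components (UNIV - nodal_set u)"

(* A C-infinity parametrized curve with nowhere vanishing velocity;
   D k is the k-th derivative of g. *)
definition regular_parametrization :: "(real \<Rightarrow> 'a::real_normed_vector) \<Rightarrow> bool" where
  "regular_parametrization g \<longleftrightarrow>
     (\<exists>D :: nat \<Rightarrow> real \<Rightarrow> 'a. D 0 = g
        \<and> (\<forall>k t. (D k has_vector_derivative D (Suc k) t) (at t))
        \<and> (\<forall>t. D 1 t \<noteq> 0))"

(* Curves without end points and without self-intersections: either an open arc or a
   closed curve. For an open arc, injectivity alone would admit a figure like "6", where
   one end runs back into the curve; hence the parametrization has to be a homeomorphism
   onto its image. For a closed curve this is automatic, by compactness of the circle. *)
definition simple_regular_curve :: "'a::real_normed_vector set \<Rightarrow> bool" where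
  "simple_regular_curve C \<longleftrightarrow>
     (\<exists>g :: real \<Rightarrow> 'a. regular_parametrization g \<and>
        ((\<exists>h. homeomorphism UNIV C g h)
         \<or> (\<exists>T>0. (\<forall>t. g (t + T) = g t) \<and> inj_on g {0..<T} \<and> range g = C)))"

end

(*
  Reflections in the coordinate axes and the exchange of x and y reduce the nodal set to the
  curve H(x) = a H(y) with a < 1 close to 1. From H'' = 2 t H' - 2 n H the energy
  H^2 + H'^2 / (2 n) increases with |t|, so the critical values of H increase strictly in
  absolute value away from the origin; hence the curve has no singular point. If d < d' are
  consecutive positive critical points, the part of the curve in [-d', d']^2 consists of the
  part in [-d, d]^2 and two arcs, exchanged by z -> -z, which turn around the smaller square
  and are attached to its curve near the corners (d, d) and (-d, -d). By induction the curve
  is connected: a double spiral.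

  A connected, unbounded, regular level curve is a single non-periodic orbit of its Hamiltonian
  field. Damping that field by exp(-x^2-y^2) makes it bounded and Lipschitz, so the orbit is
  defined for all times and gives the regular parametrization. Each of the two sides of the
  curve is locally connected along the connected curve, which makes it globally connected.
*)
theory Submission
  imports Defs
begin

section \<open>Connectedness of the curve $h(x) = b\,h(y)$\<close>

text \<open>For a = 1 the curve contains the diagonal, and other branches cross it at (e, e) for
  every critical point e of H. Lowering a opens all these crossings, and connectedness depends on
  how the loose ends pair up across all of them. This is why the argument grows squares and treats
  one pair of opposite crossings (e, e), (-e, -e) at a time. How close to 1 the factor has to be is
  settled by finitely many numbers: the ratios |H(e)| / |H(d)| for critical points 0 < e < d are all
  below 1, and a only has to exceed the largest of them. Since the original factor is - tan theta,
  this determines the two intervals of angles. The excluded angles are those with |tan theta| = 1,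
  where the crossings, if any, remain.\<close>

lemma connected_implicit_graph:
  fixes f :: "'a::topological_space \<Rightarrow> real" and k :: "'b::t2_space \<Rightarrow> real"
  assumes X: "connected X" and Y: "compact Y" and f: "continuous_on X f" and k: "continuous_on Y k"
    and inj: "inj_on k Y" and sub: "f ` X \<subseteq> k ` Y"
  shows "connected {(x, y). x \<in> X \<and> y \<in> Y \<and> f x = k y}"
proof -
  let ?r = "\<lambda>x. inv_into Y k (f x)"
  \<comment> \<open>Compactness of \<open>Y\<close> makes the inverse of the injective
    \<open>k\<close> continuous, so the set is the graph of a continuous function on
    \<open>X\<close>.\<close>
  have "continuous_on (k ` Y) (inv_into Y k)"
    using k Y inj by (intro continuous_on_inv) auto
  hence "continuous_on X ?r"
    using f sub by (rule continuous_on_compose2)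
  hence "connected ((\<lambda>x. (x, ?r x)) ` X)"
    by (intro connected_continuous_image X continuous_on_Pair continuous_on_id)
  moreover have "(\<lambda>x. (x, ?r x)) ` X = {(x, y). x \<in> X \<and> y \<in> Y \<and> f x = k y}"
  proof (safe)
    fix x assume x: "x \<in> X"
    with sub have m: "f x \<in> k ` Y" by auto
    show "?r x \<in> Y" using m by (rule inv_into_into)
    show "f x = k (?r x)" using m by (simp add: f_inv_into_f)
  next
    fix x y assume "x \<in> X" "y \<in> Y" "f x = k y"
    thus "(x, y) \<in> (\<lambda>x. (x, ?r x)) ` X"
      using inj by (auto intro!: image_eqI[of _ _ x])
  qed
  ultimately show ?thesis by simp
qed

lemma connected_implicit_graph':
  fixes f :: "'a::topological_space \<Rightarrow> real" and k :: "'b::t2_space \<Rightarrow> real"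
  assumes "connected X" "compact Y" "continuous_on X f" "continuous_on Y k"
    "inj_on k Y" "f ` X \<subseteq> k ` Y"
  shows "connected {(y, x). x \<in> X \<and> y \<in> Y \<and> k y = f x}"
proof -
  have "connected (prod.swap ` {(x, y). x \<in> X \<and> y \<in> Y \<and> f x = k y})"
    by (intro connected_continuous_image connected_implicit_graph assms continuous_on_swap)
  also have "prod.swap ` {(x, y). x \<in> X \<and> y \<in> Y \<and> f x = k y} = {(y, x). x \<in> X \<and> y \<in> Y \<and> k y = f x}"
    by force
  finally show ?thesis .
qed

definition level_curve :: "(real \<Rightarrow> real) \<Rightarrow> real \<Rightarrow> (real \<times> real) set" where
  "level_curve h b = {(x, y). h x = b * h y}"

definition centred_square :: "real \<Rightarrow> (real \<times> real) set" where
  "centred_square d = {- d..d} \<times> {- d..d}"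

lemma level_curve_uminus_fun: "level_curve (\<lambda>t. - h t) b = level_curve h b"
  by (auto simp: level_curve_def)

text \<open>The curve in the larger square is the curve in the smaller one together with an arc \<open>T\<close> and its
  mirror image \<open>- T\<close>. The part \<open>Top\<close> of \<open>T\<close> is a graph over \<open>x \<in> [\<xi>1, \<xi>]\<close> that starts on the top edge
  of the smaller square, and \<open>Left\<close> is a graph over \<open>y\<close>; they meet in \<open>(\<xi>1, e)\<close>. The strict inequality
  \<open>a < 1\<close> decides at every corner which of the two coordinates turns back.\<close>

lemma connected_level_curve_step:
  fixes h :: "real \<Rightarrow> real"
  assumes a: "0 < a" "a < 1" and cont: "\<And>S. continuous_on S h" and odd: "\<And>t. h (- t) = - h t"
    and e: "0 < e" "e < d"
    and dec: "\<And>s t. e \<le> s \<Longrightarrow> s < t \<Longrightarrow> t \<le> d \<Longrightarrow> h t < h s"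
    and he: "0 < h e" and hd: "a * h d < - h e"
    and bd: "\<And>x. \<bar>x\<bar> \<le> e \<Longrightarrow> \<bar>h x\<bar> \<le> h e"
    and e': "- e \<le> e'" "e' < e"
    and inc: "\<And>s t. e' \<le> s \<Longrightarrow> s < t \<Longrightarrow> t \<le> e \<Longrightarrow> h s < h t"
    and low: "\<And>x. - e \<le> x \<Longrightarrow> x \<le> e' \<Longrightarrow> h x < a * h e"
    and IH: "connected (level_curve h a \<inter> centred_square e)"
  shows "connected (level_curve h a \<inter> centred_square d)"
proof -
  let ?Z = "level_curve h a"
  have ahe: "0 < a * h e" "a * h e < h e" using a he by auto
  have hd': "h d < - h e"
  proof (rule ccontr)
    assume "\<not> ?thesis"
    hence "a * h d \<ge> a * (- h e)" using a by (intro mult_left_mono) auto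
    with hd ahe show False by simp
  qed
  have dec': "h s > h t" if "- d \<le> s" "s < t" "t \<le> - e" for s t
    using dec[of "-t" "-s"] that odd[of s] odd[of t] by simp
  have decle: "h t \<le> h s" if "e \<le> s" "s \<le> t" "t \<le> d" for s t
    using dec[of s t] that by (cases "s = t") auto
  have decle': "h t \<le> h s" if "- d \<le> s" "s \<le> t" "t \<le> - e" for s t
    using dec'[of s t] that by (cases "s = t") auto
  \<comment> \<open>On [-d, e] the line y = \<open>e\<close> meets the curve exactly at x =
    \<open>\<xi>1\<close> and x = \<open>\<xi>\<close>. The first lies outside the smaller square;
    the second is on its top edge, strictly left of the corner because a h(e) < h(e).\<close>
  obtain \<xi> where xi: "e' \<le> \<xi>" "\<xi> \<le> e" "h \<xi> = a * h e"
    using IVT'[of h e' "a * h e" e, OF _ _ _ cont] low[of e'] e' a ahe by auto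
  have xi_le: "h x \<le> a * h e" if "- e \<le> x" "x \<le> \<xi>" for x
    using low[of x] inc[of x \<xi>] that xi by (cases "x \<le> e'"; cases "x = \<xi>") auto
  have xi_gt: "h x > a * h e" if "\<xi> < x" "x \<le> e" for x
    using inc[of \<xi> x] that xi by auto
  obtain \<xi>1 where xi1: "- d \<le> \<xi>1" "\<xi>1 \<le> - e" "h \<xi>1 = a * h e"
    using IVT2'[of h "- e" "a * h e" "- d", OF _ _ _ cont] odd[of e] odd[of d] e a ahe hd' he by auto
  have xi1_gt: "h x > a * h e" if "- d \<le> x" "x < \<xi>1" for x
    using dec'[of x \<xi>1] that xi1 by auto
  define Top where "Top = {(x, y). x \<in> {\<xi>1..\<xi>} \<and> y \<in> {e..d} \<and> h x = a * h y}"
  define Left where "Left = {(x, y). y \<in> {- d..e} \<and> x \<in> {- d..- e} \<and> h x = a * h y}"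
  define T where "T = Top \<union> Left"
  have xi_ge: "- e \<le> \<xi>" using xi e' by simp
  have imD: "h ` {e..d} = {h d..h e}"
  proof (intro equalityI subsetI)
    fix v assume "v \<in> {h d..h e}"
    thus "v \<in> h ` {e..d}" using IVT2'[of h d v e, OF _ _ _ cont] e by auto
  qed (auto intro: decle)
  have imD': "h ` {- d..- e} = {- h e..- h d}"
  proof (intro equalityI subsetI)
    fix v assume "v \<in> {- h e..- h d}"
    thus "v \<in> h ` {- d..- e}" using IVT2'[of h "-e" v "-d", OF _ _ _ cont] e odd[of e] odd[of d] by auto
  next
    fix v assume "v \<in> h ` {- d..- e}"
    then obtain x where x: "v = h x" "- d \<le> x" "x \<le> - e" by auto
    show "v \<in> {- h e..- h d}"
      using decle'[of "- d" x] decle'[of x "- e"] x odd[of e] odd[of d] by auto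
  qed
  have inj: "inj_on h {e..d}"
    by (rule linorder_inj_onI) (use dec in force)+
  have inj': "inj_on h {- d..- e}"
    by (rule linorder_inj_onI) (use dec' in force)+
  have "connected Top"
    unfolding Top_def
  proof (rule connected_implicit_graph)
    show "inj_on (\<lambda>y. a * h y) {e..d}" using inj a by (auto simp: inj_on_def)
    show "h ` {\<xi>1..\<xi>} \<subseteq> (\<lambda>y. a * h y) ` {e..d}"
    proof safe
      fix x assume x: "x \<in> {\<xi>1..\<xi>}"
      have "- h e \<le> h x \<and> h x \<le> a * h e"
      proof (cases "x \<le> - e")
        case True
        thus ?thesis using decle'[of x "- e"] decle'[of \<xi>1 x] x xi1 odd[of e] by auto
      next
        case False
        hence "\<bar>x\<bar> \<le> e" using x xi by (auto simp: abs_le_iff)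
        thus ?thesis using bd[of x] xi_le[of x] x False by simp
      qed
      \<comment> \<open>The lower bound is h(x) >= - h(e) > a h(d): by \<open>hd\<close>, h falls
        far enough on [e, d] for the arc to pass over the whole of [\<open>\<xi>1\<close>,
        \<open>\<xi>\<close>].\<close>
      hence "h x / a \<in> {h d..h e}" using hd a by (auto simp: field_simps)
      then obtain y where "y \<in> {e..d}" "h x / a = h y" using imD by force
      thus "h x \<in> (\<lambda>y. a * h y) ` {e..d}" using a by (auto intro!: image_eqI[of _ _ y] simp: field_simps)
    qed
  qed (auto intro!: continuous_intros cont)
  moreover have "connected Left"
    unfolding Left_def
  proof (rule connected_implicit_graph')
    show "(\<lambda>y. a * h y) ` {- d..e} \<subseteq> h ` {- d..- e}"
    proof safe
      fix y assume y: "y \<in> {- d..e}"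
      have "- h e \<le> h y \<and> h y \<le> - h d"
      proof (cases "y \<le> - e")
        case True
        thus ?thesis using imD' y by force
      next
        case False
        hence "\<bar>y\<bar> \<le> e" using y by (auto simp: abs_le_iff)
        thus ?thesis using bd[of y] hd' by (auto simp: abs_le_iff)
      qed
      hence "a * (- h e) \<le> a * h y \<and> a * h y \<le> a * (- h d)"
        using a by (intro conjI mult_left_mono) auto
      moreover have "a * (- h d) \<le> 1 * (- h d)" using a hd' he by (intro mult_right_mono) auto
      ultimately show "a * h y \<in> h ` {- d..- e}" unfolding imD' using ahe by auto
    qed
  qed (auto intro!: continuous_intros cont inj')
  moreover have "(\<xi>1, e) \<in> Top \<inter> Left"
    using xi1 xi_ge e xi by (auto simp: Top_def Left_def)
  ultimately have T: "connected T"
    unfolding T_def by (intro connected_Un) auto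
  hence T': "connected (uminus ` T)"
    by (intro connected_continuous_image continuous_intros)
  have xiT: "(\<xi>, e) \<in> T" "(\<xi>, e) \<in> ?Z \<inter> centred_square e"
    using xi xi_ge xi1 e by (auto simp: T_def Top_def level_curve_def centred_square_def)
  have "(- \<xi>, - e) \<in> uminus ` T" "(- \<xi>, - e) \<in> ?Z \<inter> centred_square e"
    using xiT odd by (auto simp: level_curve_def centred_square_def intro!: image_eqI[of _ _ "(\<xi>, e)"])
  hence "connected ((?Z \<inter> centred_square e \<union> T) \<union> uminus ` T)"
    using IH T T' xiT by (intro connected_Un) auto
  also have "(?Z \<inter> centred_square e \<union> T) \<union> uminus ` T = ?Z \<inter> centred_square d"
  proof (intro equalityI subsetI)
    fix z assume "z \<in> (?Z \<inter> centred_square e \<union> T) \<union> uminus ` T"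
    thus "z \<in> ?Z \<inter> centred_square d"
      using e xi xi1 odd
      by (auto simp: T_def Top_def Left_def level_curve_def centred_square_def)
  next
    fix z assume "z \<in> ?Z \<inter> centred_square d"
    then obtain x y where z: "z = (x, y)" "h x = a * h y" "- d \<le> x" "x \<le> d" "- d \<le> y" "y \<le> d"
      by (auto simp: level_curve_def centred_square_def)
    have top: "(x, y) \<in> Top" if "h x = a * h y" "- d \<le> x" "x \<le> e" "e < y" "y \<le> d" for x y
    proof -
      have "h x \<le> a * h e" using that decle[of e y] a by auto
      hence "\<xi>1 \<le> x" "x \<le> \<xi>" using xi1_gt[of x] xi_gt[of x] that by force+
      thus ?thesis using that by (auto simp: Top_def)
    qed
    have mem: "(x, y) \<in> uminus ` T" if "(- x, - y) \<in> T" for x y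
      using that by (auto intro!: image_eqI[of _ _ "(- x, - y)"])
    have zn: "h (- x) = a * h (- y)" using z odd by simp
    \<comment> \<open>The frame between the squares is cut like a pinwheel into four disjoint
      rectangles, each containing one corner of the frame; z -> -z exchanges cases 1 and 3, and
      cases 2 and 4.\<close>
    consider "e < y" "x \<le> e" | "e < x" "- e \<le> y" | "y < - e" "- e \<le> x" | "x < - e" "y \<le> e"
      | "\<bar>x\<bar> \<le> e" "\<bar>y\<bar> \<le> e"
      using e by (smt (verit))
    thus "z \<in> (?Z \<inter> centred_square e \<union> T) \<union> uminus ` T"
    proof cases
      case 1
      thus ?thesis using top[of x y] z by (auto simp: T_def)
    next
      case 2
      hence "(- x, - y) \<in> Left" using z zn by (auto simp: Left_def)
      thus ?thesis using mem z by (auto simp: T_def)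
    next
      case 3
      hence "(- x, - y) \<in> Top" using z zn by (intro top) auto
      thus ?thesis using mem z by (auto simp: T_def)
    next
      case 4
      thus ?thesis using z by (auto simp: T_def Left_def)
    next
      case 5
      thus ?thesis using z by (auto simp: level_curve_def centred_square_def)
    qed
  qed
  finally show ?thesis .
qed

text \<open>With \<open>N = 2 n\<close>, the first-order form of \<open>h'' = 2 t h' - 2 n h\<close>; the critical points of \<open>h\<close> are the
  zeros of \<open>g\<close>.\<close>

locale hermite_like =
  fixes h g :: "real \<Rightarrow> real" and N :: real
  assumes h: "\<And>t. (h has_real_derivative N * g t) (at t)"
    and g: "\<And>t. (g has_real_derivative 2 * t * g t - h t) (at t)"
    and N: "0 < N" and odd: "\<And>t. h (- t) = - h t" and g0: "g 0 \<noteq> 0"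
    and even: "\<And>t. g (- t) = g t"
    and fin: "finite {t. g t = 0}"
begin

text \<open>Since h' = N g, this is h^2 + h'^2 / N. In its derivative the products h g
  cancel.\<close>

definition energy :: "real \<Rightarrow> real" where "energy t = (h t)\<^sup>2 + N * (g t)\<^sup>2"

lemma energy_deriv: "(energy has_real_derivative 4 * N * t * (g t)\<^sup>2) (at t)"
  unfolding energy_def
  by (auto intro!: derivative_eq_intros h g simp: power2_eq_square algebra_simps)

lemma energy_mono: "0 \<le> s \<Longrightarrow> s \<le> t \<Longrightarrow> energy s \<le> energy t"
  by (rule DERIV_nonneg_imp_nondecreasing) (use energy_deriv N in force)+

text \<open>The derivative 4 N t g^2 is positive for t > 0 except at the finitely many zeros of
  \<open>g\<close>. At a point between s and t that avoids them the energy gains strictly, and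
  monotonicity carries the gain to t.\<close>

lemma energy_strict_mono:
  assumes "0 \<le> s" "s < t" shows "energy s < energy t"
proof -
  have "infinite {s<..<t}" using assms by simp
  hence "{s<..<t} - {t. g t = 0} \<noteq> {}" using fin by (metis Diff_eq_empty_iff finite_subset)
  then obtain u where "u \<in> {s<..<t}" "g u \<noteq> 0" by blast
  hence u: "s < u" "u < t" "g u \<noteq> 0" by auto
  hence "0 < 4 * N * u * (g u)\<^sup>2" using N assms by simp
  from DERIV_pos_inc_right[OF energy_deriv this]
  obtain d where d: "0 < d" "\<And>v. 0 < v \<Longrightarrow> v < d \<Longrightarrow> energy u < energy (u + v)" by blast
  define v where "v = min (d / 2) (t - u)"
  have v: "0 < v" "v < d" "u + v \<le> t" using d u by (auto simp: v_def)
  have "energy s \<le> energy u" using u assms by (intro energy_mono) auto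
  also have "\<dots> < energy (u + v)" using d v by auto
  also have "\<dots> \<le> energy t" using u assms v by (intro energy_mono) auto
  finally show ?thesis .
qed

lemma energy_pos: "0 < energy t"
proof -
  have "0 < energy 0" using g0 N by (simp add: energy_def add_nonneg_pos)
  also have "energy 0 \<le> energy \<bar>t\<bar>" by (rule energy_mono) auto
  also have "energy \<bar>t\<bar> = energy t" by (cases "0 \<le> t") (auto simp: energy_def odd even)
  finally show ?thesis .
qed

lemma critical_value_nonzero: "g e = 0 \<Longrightarrow> h e \<noteq> 0"
  using energy_pos[of e] by (auto simp: energy_def)

text \<open>At a zero of \<open>g\<close> the energy equals h^2, and elsewhere it bounds h^2 from
  above; monotonicity of the energy does the rest.\<close>

lemma abs_le_critical_value:
  assumes "g e = 0" "\<bar>x\<bar> \<le> e" shows "\<bar>h x\<bar> \<le> \<bar>h e\<bar>"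
proof -
  have "(h x)\<^sup>2 \<le> energy x" using N by (simp add: energy_def)
  also have "energy x = energy \<bar>x\<bar>" by (cases "0 \<le> x") (auto simp: energy_def odd even)
  also have "\<dots> \<le> energy e" using assms by (intro energy_mono) auto
  also have "\<dots> = (h e)\<^sup>2" using assms by (simp add: energy_def)
  finally show ?thesis by (simp add: abs_le_square_iff)
qed

lemma critical_values_increasing:
  assumes "g e = 0" "g d = 0" "0 \<le> e" "e < d" shows "\<bar>h e\<bar> < \<bar>h d\<bar>"
proof -
  have "(h e)\<^sup>2 < (h d)\<^sup>2" using energy_strict_mono[of e d] assms by (simp add: energy_def)
  thus ?thesis by (metis abs_le_square_iff not_le)
qed

lemma continuous: "continuous_on S h" "continuous_on S g"
  using h g DERIV_isCont continuous_at_imp_continuous_on by blast+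

lemma surjective:
  assumes lim: "filterlim (\<lambda>t. \<bar>h t\<bar>) at_top at_top"
  shows "\<exists>t. h t = c"
proof -
  have "eventually (\<lambda>t. \<bar>c\<bar> \<le> \<bar>h t\<bar> \<and> 0 < t) at_top"
    using lim by (intro eventually_conj eventually_gt_at_top) (auto simp: filterlim_at_top)
  then obtain R where "\<bar>c\<bar> \<le> \<bar>h R\<bar>" "0 < R" by (auto simp: eventually_at_top_linorder)
  thus ?thesis
    using IVT'[of h "- R" c R, OF _ _ _ continuous(1)]
      IVT2'[of h R c "- R", OF _ _ _ continuous(1)] odd[of R]
    by (cases "0 \<le> h R") (auto simp: abs_le_iff)
qed

lemma monotone_between_critical:
  assumes "s < t" and nz: "\<And>x. s < x \<Longrightarrow> x < t \<Longrightarrow> g x \<noteq> 0"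
  shows "(\<forall>x y. s \<le> x \<and> x < y \<and> y \<le> t \<longrightarrow> h x < h y) \<and> (\<forall>x. s < x \<and> x < t \<longrightarrow> 0 < g x)
    \<or> (\<forall>x y. s \<le> x \<and> x < y \<and> y \<le> t \<longrightarrow> h y < h x) \<and> (\<forall>x. s < x \<and> x < t \<longrightarrow> g x < 0)"
proof (cases "\<exists>x. s < x \<and> x < t \<and> g x > 0")
  case True
  then obtain x0 where x0: "s < x0" "x0 < t" "g x0 > 0" by auto
  have pos: "0 < g x" if "s < x" "x < t" for x
  proof (rule ccontr)
    assume "\<not> 0 < g x"
    hence "g x < 0" using nz[of x] that by force
    hence "\<exists>y. min x x0 \<le> y \<and> y \<le> max x x0 \<and> g y = 0"
      using IVT'[of g x 0 x0, OF _ _ _ continuous(2)] IVT2'[of g x 0 x0, OF _ _ _ continuous(2)] x0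
      by (cases "x \<le> x0") (auto simp: min_def max_def)
    thus False using nz x0 that by (auto simp: min_def max_def split: if_splits)
  qed
  have "h x < h y" if "s \<le> x" "x < y" "y \<le> t" for x y
    by (rule DERIV_pos_imp_increasing_open[OF \<open>x < y\<close> _ continuous(1)])
       (use h pos that N in \<open>auto intro!: exI[of _ "N * g _"]\<close>)
  thus ?thesis using pos by auto
next
  case False
  hence neg: "g x < 0" if "s < x" "x < t" for x using nz[of x] that by force
  have "h y < h x" if "s \<le> x" "x < y" "y \<le> t" for x y
    by (rule DERIV_neg_imp_decreasing_open[OF \<open>x < y\<close> _ continuous(1)])
       (use h neg that N in \<open>auto intro!: exI[of _ "N * g _"] simp: mult_pos_neg\<close>)
  thus ?thesis using neg by auto
qed

text \<open>At a zero of \<open>g\<close> the equation reduces to g' = - h(e) < 0. So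
  \<open>g\<close> is negative just after \<open>e\<close> and keeps this sign up to
  \<open>d\<close>.\<close>

lemma decreasing_after_max:
  assumes "g e = 0" "0 < h e" "e < d" and nz: "\<And>x. e < x \<Longrightarrow> x < d \<Longrightarrow> g x \<noteq> 0"
    and "e \<le> s" "s < t" "t \<le> d"
  shows "h t < h s"
proof -
  have "\<not> (\<forall>x. e < x \<and> x < d \<longrightarrow> 0 < g x)"
  proof
    assume pos: "\<forall>x. e < x \<and> x < d \<longrightarrow> 0 < g x"
    have "2 * e * g e - h e < 0" using assms by simp
    from DERIV_neg_dec_right[OF g this]
    obtain k where k: "0 < k" "\<And>v. 0 < v \<Longrightarrow> v < k \<Longrightarrow> g e > g (e + v)" by blast
    define v where "v = min (k / 2) ((d - e) / 2)"
    have "0 < v" "v < k" "v < d - e" using k assms by (auto simp: v_def min_def)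
    thus False using k(2)[of v] pos assms(1) by (force dest: spec[of _ "e + v"])
  qed
  thus ?thesis using monotone_between_critical[OF assms(3) nz] assms by blast
qed

end

text \<open>The factor \<open>a\<close> is so close to 1 that multiplying by it does not change the order of the critical
  values.\<close>

locale hermite_like_ratio = hermite_like +
  fixes a :: real
  assumes a: "0 < a" "a < 1"
    and ratio: "\<And>e d. 0 < e \<Longrightarrow> e < d \<Longrightarrow> g e = 0 \<Longrightarrow> g d = 0 \<Longrightarrow> \<bar>h e\<bar> < a * \<bar>h d\<bar>"
begin

lemma step_at_max:
  assumes e: "0 < e" "e < d" "g e = 0" "0 < h e" and nz: "\<And>x. e < x \<Longrightarrow> x < d \<Longrightarrow> g x \<noteq> 0"
    and big: "\<bar>h e\<bar> < a * \<bar>h d\<bar>"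
    and IH: "connected (level_curve h a \<inter> centred_square e)"
  shows "connected (level_curve h a \<inter> centred_square d)"
proof -
  have dec: "h t < h s" if "e \<le> s" "s < t" "t \<le> d" for s t
    using decreasing_after_max[of e d s t] e nz that by blast
  have ahe: "a * h e < h e" "0 < a * h e" using a e by auto
  \<comment> \<open>If h(d) were nonnegative, then h(e) < a h(d) <= h(d) < h(e). So h(d) is
    negative, and \<open>big\<close> takes the required form.\<close>
  have hd: "a * h d < - h e"
  proof -
    have "h d < h e" using dec e by simp
    moreover have "h e < a * h d" if "0 \<le> h d" using big that e by simp
    moreover have "a * h d \<le> h d" if "0 \<le> h d" using a that by (simp add: mult_left_le_one_le)
    ultimately have "h d < 0" by force
    thus ?thesis using big e by simp
  qed
  define C where "C = {t. 0 < t \<and> t < e \<and> g t = 0}"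
  have C: "finite C" using fin by (rule finite_subset[rotated]) (auto simp: C_def)
  \<comment> \<open>\<open>e'\<close> is the last positive critical point before \<open>e\<close>;
    if there is none, h is monotone on [-e, e] and -e takes its place. In the first case the ratio
    condition puts |h(e')| below a h(e), and with it all values of h on [-e, e'].\<close>
  obtain e' where e': "- e \<le> e'" "e' < e" "\<And>x. e' < x \<Longrightarrow> x < e \<Longrightarrow> g x \<noteq> 0"
    and low: "\<And>x. - e \<le> x \<Longrightarrow> x \<le> e' \<Longrightarrow> h x < a * h e"
  proof (cases "C = {}")
    case True
    show ?thesis
    proof (rule that[of "- e"])
      fix x assume x: "- e < x" "x < e"
      consider "x = 0" | "0 < x" | "0 < - x" by linarith
      thus "g x \<noteq> 0"
        using True x g0 even[of x] unfolding C_def by cases force+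
    next
      fix x assume "- e \<le> x" "x \<le> - e"
      hence "x = - e" by simp
      thus "h x < a * h e" using odd[of e] e ahe by simp
    qed (use e in auto)
  next
    case False
    define e' where "e' = Max C"
    have "e' \<in> C" using Max_in C False by (simp add: e'_def)
    hence e': "0 < e'" "e' < e" "g e' = 0" by (auto simp: C_def)
    have nz': "g x \<noteq> 0" if "e' < x" "x < e" for x
    proof
      assume "g x = 0"
      hence "x \<in> C" using that e' by (auto simp: C_def)
      hence "x \<le> e'" using C by (simp add: e'_def)
      thus False using that by simp
    qed
    have lt: "\<bar>h e'\<bar> < a * h e" using ratio[of e' e] e e' by simp
    have mono: "h x < h y" if "e' \<le> x" "x < y" "y \<le> e" for x y
    proof -
      have "\<not> (h e < h e')" using lt ahe by auto
      thus ?thesis using monotone_between_critical[of e' e] nz' e' that by blast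
    qed
    show ?thesis
    proof (rule that[of e'])
      fix x assume x: "- e \<le> x" "x \<le> e'"
      show "h x < a * h e"
      proof (cases "x < - e'")
        case True
        have "h e' < h (- x)" using mono[of e' "- x"] True x by simp
        thus ?thesis using odd[of x] lt by simp
      next
        case False
        thus ?thesis using abs_le_critical_value[of e' x] e' x lt by (simp add: abs_le_iff)
      qed
    qed (use e' nz' e in auto)
  qed
  have inc: "h s < h t" if "e' \<le> s" "s < t" "t \<le> e" for s t
  proof -
    have "\<not> (h e < h e')" using low[of e'] e' ahe by auto
    thus ?thesis using monotone_between_critical[of e' e] e' that by blast
  qed
  show ?thesis
    by (rule connected_level_curve_step[of a h e d e'])
       (use a continuous(1) odd e dec hd e' low inc IH abs_le_critical_value[of e] in auto)
qed

end

text \<open>As h and -h have the same level curves, this reduces a critical point with negative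
  value to one with positive value.\<close>

lemma (in hermite_like_ratio) neg: "hermite_like_ratio (\<lambda>t. - h t) (\<lambda>t. - g t) N a"
proof
  show "((\<lambda>t. - h t) has_real_derivative N * - g t) (at t)" for t
    using DERIV_minus[OF h] by simp
  show "((\<lambda>t. - g t) has_real_derivative 2 * t * - g t - - h t) (at t)" for t
    using DERIV_minus[OF g, of t] by (simp add: algebra_simps)
qed (use N odd g0 even fin a ratio in auto)

context hermite_like_ratio
begin

lemma step:
  assumes e: "0 < e" "e < d" "g e = 0" and nz: "\<And>x. e < x \<Longrightarrow> x < d \<Longrightarrow> g x \<noteq> 0"
    and big: "\<bar>h e\<bar> < a * \<bar>h d\<bar>"
    and IH: "connected (level_curve h a \<inter> centred_square e)"
  shows "connected (level_curve h a \<inter> centred_square d)"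
proof (cases "0 < h e")
  case True
  thus ?thesis using step_at_max assms by blast
next
  case False
  hence "0 < - h e" using critical_value_nonzero[OF e(3)] by simp
  from hermite_like_ratio.step_at_max[OF neg e(1,2) _ this, unfolded level_curve_uminus_fun]
  show ?thesis using assms by simp
qed

text \<open>The condition on \<open>d\<close> holds at critical points by \<open>ratio\<close>, and
  at every large \<open>d\<close> because |h| then exceeds all critical values by a factor 1/a. So
  one induction, on the number of critical points below \<open>d\<close>, covers the intermediate
  squares and those that exhaust the plane.\<close>

lemma connected_level_curve_box:
  assumes "0 < d" and "\<And>e. 0 < e \<Longrightarrow> e < d \<Longrightarrow> g e = 0 \<Longrightarrow> \<bar>h e\<bar> < a * \<bar>h d\<bar>"
  shows "connected (level_curve h a \<inter> centred_square d)"
  using assms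
proof (induction "card {t. 0 < t \<and> t < d \<and> g t = 0}" arbitrary: d rule: less_induct)
  case less
  define C where "C d = {t. 0 < t \<and> t < d \<and> g t = 0}" for d
  have C: "finite (C d)" for d using fin by (rule finite_subset[rotated]) (auto simp: C_def)
  show ?case
  proof (cases "C d = {}")
    case True
    have nz: "g x \<noteq> 0" if "- d < x" "x < d" for x
    proof -
      consider "x = 0" | "0 < x" | "0 < - x" by linarith
      thus ?thesis using True that g0 even[of x] unfolding C_def by cases force+
    qed
    \<comment> \<open>Without critical points in the square, the curve is the graph x = h^{-1}(a
      h(y)) over the y-axis; a < 1 keeps a h(y) in the range of h.\<close>
    have "inj_on h {- d..d}"
      using monotone_between_critical[of "- d" d] nz less(2)
      by (intro linorder_inj_onI) (force, rule linear)
    moreover have "(\<lambda>y. a * h y) ` {- d..d} \<subseteq> h ` {- d..d}"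
    proof safe
      fix y assume y: "y \<in> {- d..d}"
      have "\<bar>h y\<bar> \<le> \<bar>h d\<bar>"
      proof (cases "y = d \<or> y = - d")
        case True
        thus ?thesis using odd[of d] by auto
      next
        case False
        hence "- d < y" "y < d" using y by auto
        hence "h (- d) < h y \<and> h y < h d \<or> h d < h y \<and> h y < h (- d)"
          using monotone_between_critical[of "- d" d] nz less(2) by force
        thus ?thesis using odd[of d] by auto
      qed
      hence "\<bar>a * h y\<bar> \<le> 1 * \<bar>h d\<bar>" unfolding abs_mult using a by (intro mult_mono) auto
      hence "\<exists>x. - d \<le> x \<and> x \<le> d \<and> h x = a * h y"
        using IVT'[of h "- d" "a * h y" d, OF _ _ _ continuous(1)]
          IVT2'[of h d "a * h y" "- d", OF _ _ _ continuous(1)] odd[of d] less(2)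
        by (cases "0 \<le> h d") auto
      thus "a * h y \<in> h ` {- d..d}" by force
    qed
    ultimately have "connected {(x, y). y \<in> {- d..d} \<and> x \<in> {- d..d} \<and> h x = a * h y}"
      by (intro connected_implicit_graph') (auto intro!: continuous_intros continuous)
    moreover have "{(x, y). y \<in> {- d..d} \<and> x \<in> {- d..d} \<and> h x = a * h y} = level_curve h a \<inter> centred_square d"
      by (auto simp: level_curve_def centred_square_def)
    ultimately show ?thesis by simp
  next
    case False
    define e where "e = Max (C d)"
    have "e \<in> C d" using Max_in C False by (simp add: e_def)
    hence e: "0 < e" "e < d" "g e = 0" by (auto simp: C_def)
    have nz: "g x \<noteq> 0" if "e < x" "x < d" for x
    proof
      assume "g x = 0"
      hence "x \<in> C d" using that e by (auto simp: C_def)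
      hence "x \<le> e" using C by (simp add: e_def)
      thus False using that by simp
    qed
    have "C e \<subset> C d" using e by (auto simp: C_def)
    hence "card (C e) < card (C d)" by (intro psubset_card_mono C)
    hence "connected (level_curve h a \<inter> centred_square e)"
      using less(1)[of e] e ratio by (simp add: C_def)
    thus ?thesis using step[OF e nz less(3)[OF e]] by blast
  qed
qed

lemma connected_level_curve:
  assumes lim: "filterlim (\<lambda>t. \<bar>h t\<bar>) at_top at_top"
  shows "connected (level_curve h a)"
proof -
  \<comment> \<open>\<open>B\<close> bounds all critical values. The inserted 0 keeps
    \<open>Max\<close> meaningful when there are none, as in degree 1.\<close>
  define B where "B = Max (insert 0 ((\<lambda>t. \<bar>h t\<bar>) ` {t. g t = 0}))"
  have B: "\<bar>h t\<bar> \<le> B" if "g t = 0" for t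
    unfolding B_def using that fin by (intro Max_ge) auto
  have "eventually (\<lambda>t. B / a < \<bar>h t\<bar>) at_top" using lim by (simp add: filterlim_at_top_dense)
  then obtain R where R: "\<And>t. R \<le> t \<Longrightarrow> B / a < \<bar>h t\<bar>" by (auto simp: eventually_at_top_linorder)
  have con: "connected (level_curve h a \<inter> centred_square d)" if "R \<le> d" "0 < d" for d
  proof (rule connected_level_curve_box[OF that(2)])
    fix e assume "g e = 0"
    thus "\<bar>h e\<bar> < a * \<bar>h d\<bar>" using B[of e] R[OF that(1)] a by (simp add: field_simps)
  qed
  let ?S = "\<lambda>d. level_curve h a \<inter> centred_square d"
  have "connected (\<Union> (?S ` {d. R \<le> d \<and> 0 < d}))"
  proof (rule connected_Union)
    have "(0, 0) \<in> \<Inter> (?S ` {d. R \<le> d \<and> 0 < d})"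
      using odd[of 0] by (auto simp: level_curve_def centred_square_def)
    thus "\<Inter> (?S ` {d. R \<le> d \<and> 0 < d}) \<noteq> {}" by blast
  qed (use con in auto)
  also have "\<Union> (?S ` {d. R \<le> d \<and> 0 < d}) = level_curve h a"
  proof safe
    fix x y assume "(x, y) \<in> level_curve h a"
    thus "(x, y) \<in> \<Union> (?S ` {d. R \<le> d \<and> 0 < d})"
      by (intro UN_I[of "max (\<bar>R\<bar> + 1) (max \<bar>x\<bar> \<bar>y\<bar>)"]) (auto simp: centred_square_def)
  qed
  finally show ?thesis .
qed

end

context hermite_like
begin


text \<open>There are finitely many pairs of critical points, and the energy puts each ratio below
  1. The midpoint between the largest ratio and 1 lies strictly above every ratio; inserting 0 among
  the ratios covers the case of no pair.\<close>

lemma uniform_critical_ratio: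
  "\<exists>a. 0 < a \<and> a < 1 \<and> (\<forall>e d. 0 < e \<and> e < d \<and> g e = 0 \<and> g d = 0 \<longrightarrow> \<bar>h e\<bar> < a * \<bar>h d\<bar>)"
proof -
  define C where "C = {(e, d). 0 < e \<and> e < d \<and> g e = 0 \<and> g d = 0}"
  define P where "P = insert 0 ((\<lambda>(e, d). \<bar>h e\<bar> / \<bar>h d\<bar>) ` C)"
  have "C \<subseteq> {t. g t = 0} \<times> {t. g t = 0}" by (auto simp: C_def)
  hence "finite C" using fin finite_subset by blast
  hence P: "finite P" "P \<noteq> {}" by (auto simp: P_def)
  have "\<bar>h e\<bar> / \<bar>h d\<bar> < 1" if "(e, d) \<in> C" for e d
    using that critical_values_increasing[of e d] by (auto simp: C_def divide_less_eq_1)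
  hence "r < 1" if "r \<in> P" for r
    using that by (auto simp: P_def)
  hence M1: "Max P < 1" using P by simp
  have M0: "0 \<le> Max P" using P by (auto simp: P_def)
  have "\<bar>h e\<bar> < (1 + Max P) / 2 * \<bar>h d\<bar>" if "0 < e" "e < d" "g e = 0" "g d = 0" for e d
  proof -
    have "\<bar>h e\<bar> / \<bar>h d\<bar> \<in> P" using that by (force simp: P_def C_def)
    hence "\<bar>h e\<bar> / \<bar>h d\<bar> \<le> Max P" using P by simp
    hence "\<bar>h e\<bar> / \<bar>h d\<bar> < (1 + Max P) / 2"
      by (rule le_less_trans) (use M1 in simp)
    thus ?thesis using critical_value_nonzero[OF that(4)] by (simp add: field_simps)
  qed
  thus ?thesis using M0 M1 by (intro exI[of _ "(1 + Max P) / 2"]) auto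
qed

lemma level_curve_inverse:
  assumes "b \<noteq> 0" shows "level_curve h (1 / b) = prod.swap ` level_curve h b"
  using assms by (auto simp: level_curve_def field_simps intro!: image_eqI[of _ _ "(_, _)"])

lemma level_curve_uminus: "level_curve h (- b) = (\<lambda>(x, y). (x, - y)) ` level_curve h b"
proof (intro equalityI subsetI)
  fix z assume "z \<in> level_curve h (- b)"
  thus "z \<in> (\<lambda>(x, y). (x, - y)) ` level_curve h b"
    by (cases z) (auto simp: level_curve_def odd intro!: image_eqI[of _ _ "(fst z, - snd z)"])
qed (auto simp: level_curve_def odd)

text \<open>Every b in (a, 1) inherits the ratio condition; exchanging the coordinates gives 1/b,
  and reflecting one of them gives -b. At a singular point x and y would both be critical: for |x|
  and |y| distinct the ratio condition forces |b| < a or |b| > 1/a, and for |x| = |y| it follows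
  that |b| = 1.\<close>

lemma level_curve_connected_and_regular:
  assumes lim: "filterlim (\<lambda>t. \<bar>h t\<bar>) at_top at_top"
  shows "\<exists>a. 0 < a \<and> a < 1 \<and> (\<forall>b. a < \<bar>b\<bar> \<and> \<bar>b\<bar> < 1 / a \<and> \<bar>b\<bar> \<noteq> 1 \<longrightarrow>
    connected (level_curve h b) \<and> (\<forall>x y. h x = b * h y \<longrightarrow> g x \<noteq> 0 \<or> g y \<noteq> 0))"
proof -
  obtain a where a: "0 < a" "a < 1"
    and ratio: "\<And>e d. 0 < e \<Longrightarrow> e < d \<Longrightarrow> g e = 0 \<Longrightarrow> g d = 0 \<Longrightarrow> \<bar>h e\<bar> < a * \<bar>h d\<bar>"
    using uniform_critical_ratio by blast
  have lt1: "connected (level_curve h b)" if b: "a < b" "b < 1" for b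
  proof -
    have "\<bar>h e\<bar> < b * \<bar>h d\<bar>" if "0 < e" "e < d" "g e = 0" "g d = 0" for e d
    proof -
      have "a * \<bar>h d\<bar> \<le> b * \<bar>h d\<bar>" using b by (intro mult_right_mono) auto
      thus ?thesis using ratio[OF that] by simp
    qed
    then interpret r: hermite_like_ratio h g N b
      by unfold_locales (use a b in auto)
    show ?thesis by (rule r.connected_level_curve[OF lim])
  qed
  have pos: "connected (level_curve h b)" if b: "a < b" "b < 1 / a" "b \<noteq> 1" for b
  proof (cases "b < 1")
    case True
    thus ?thesis using lt1 b by blast
  next
    case False
    have "a < 1 / b" "1 / b < 1" using b False a by (auto simp: field_simps)
    hence "connected (prod.swap ` level_curve h (1 / b))"
      by (intro connected_continuous_image continuous_on_swap lt1)
    moreover have "prod.swap ` level_curve h (1 / b) = level_curve h b"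
      using level_curve_inverse[of "1 / b"] b a by simp
    ultimately show ?thesis by simp
  qed
  have conn: "connected (level_curve h b)" if b: "a < \<bar>b\<bar>" "\<bar>b\<bar> < 1 / a" "\<bar>b\<bar> \<noteq> 1" for b
  proof (cases "0 \<le> b")
    case True
    thus ?thesis using pos b by simp
  next
    case False
    hence "connected (level_curve h (- b))" using pos[of "- b"] b by simp
    hence "connected ((\<lambda>(x, y). (x, - y)) ` level_curve h (- b))"
      by (rule connected_continuous_image[rotated]) (auto simp: case_prod_unfold intro!: continuous_intros)
    thus ?thesis using level_curve_uminus[of "- b"] by simp
  qed
  have h_abs: "\<bar>h \<bar>x\<bar>\<bar> = \<bar>h x\<bar>" for x by (cases "0 \<le> x") (auto simp: odd)
  have g_abs: "g \<bar>x\<bar> = g x" for x by (cases "0 \<le> x") (auto simp: even)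
  have reg: False
    if b: "a < \<bar>b\<bar>" "\<bar>b\<bar> < 1 / a" "\<bar>b\<bar> \<noteq> 1" and eq: "h x = b * h y" and g: "g x = 0" "g y = 0" for b x y
  proof -
    have nz: "0 < \<bar>x\<bar>" "0 < \<bar>y\<bar>" "0 < \<bar>h x\<bar>" "0 < \<bar>h y\<bar>"
      using g g0 critical_value_nonzero by auto
    have eq': "\<bar>h x\<bar> = \<bar>b\<bar> * \<bar>h y\<bar>" using eq by (simp add: abs_mult)
    consider "\<bar>x\<bar> < \<bar>y\<bar>" | "\<bar>y\<bar> < \<bar>x\<bar>" | "\<bar>x\<bar> = \<bar>y\<bar>" by linarith
    thus False
    proof cases
      case 1
      hence "\<bar>h x\<bar> < a * \<bar>h y\<bar>" using ratio[of "\<bar>x\<bar>" "\<bar>y\<bar>"] nz g by (simp add: h_abs g_abs)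
      moreover have "a * \<bar>h y\<bar> \<le> \<bar>b\<bar> * \<bar>h y\<bar>" using b by (intro mult_right_mono) auto
      ultimately show False using eq' by simp
    next
      case 2
      hence "\<bar>h y\<bar> < a * \<bar>h x\<bar>" using ratio[of "\<bar>y\<bar>" "\<bar>x\<bar>"] nz g by (simp add: h_abs g_abs)
      moreover have "(a * \<bar>b\<bar>) * \<bar>h y\<bar> \<le> 1 * \<bar>h y\<bar>"
        using b a by (intro mult_right_mono) (auto simp: field_simps)
      ultimately show False using eq' by simp
    next
      case 3
      hence "\<bar>h x\<bar> = \<bar>h y\<bar>" using h_abs[of x] h_abs[of y] by simp
      thus False using eq' nz b by simp
    qed
  qed
  show ?thesis using a conn reg by blast
qed

end


section \<open>Global flows of Lipschitz vector fields\<close>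

text \<open>Integrating C exp(K |s|) from 0 gains the factor 1/K, which later makes the Picard
  operator contract. Negative times follow by time reversal.\<close>

lemma exp_weighted_increment_bound:
  fixes F :: "real \<Rightarrow> 'a::real_normed_vector"
  assumes F: "\<And>t. (F has_vector_derivative f t) (at t)"
    and K: "0 < K" and C: "0 \<le> C" and bd: "\<And>t. norm (f t) \<le> C * exp (K * \<bar>t\<bar>)"
  shows "norm (F t - F 0) \<le> C / K * exp (K * \<bar>t\<bar>)"
proof -
  have pos: "norm (G t - G 0) \<le> C / K * exp (K * t)"
    if G: "\<And>t. (G has_vector_derivative g t) (at t)"
      and bd: "\<And>t. norm (g t) \<le> C * exp (K * \<bar>t\<bar>)" and t: "0 < t"
    for G g :: "real \<Rightarrow> 'a" and t
  proof -
    have "norm (G t - G 0) \<le> C / K * exp (K * t) - C / K * exp (K * 0)"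
    proof (rule differentiable_bound_general[OF t])
      show "continuous_on {0..t} G"
        by (rule continuous_at_imp_continuous_on) (use G has_vector_derivative_continuous in blast)
      show "((\<lambda>x. C / K * exp (K * x)) has_vector_derivative C * exp (K * x)) (at x)" for x
        unfolding has_real_derivative_iff_has_vector_derivative[symmetric]
        using K by (auto intro!: derivative_eq_intros)
      show "norm (g x) \<le> C * exp (K * x)" if "0 < x" for x
        using bd[of x] that by simp
    qed (use K in \<open>auto intro!: continuous_intros G\<close>)
    also have "\<dots> \<le> C / K * exp (K * t)" using K C by simp
    finally show ?thesis .
  qed
  consider "t = 0" | "0 < t" | "t < 0" by linarith
  thus ?thesis
  proof cases
    case 1
    thus ?thesis using K C by simp
  next
    case 2
    thus ?thesis using pos[OF F bd, of t] by simp
  next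
    case 3
    have "(uminus has_vector_derivative - 1) (at s)" for s :: real
      by (auto intro!: derivative_eq_intros simp: has_real_derivative_iff_has_vector_derivative[symmetric])
    hence "((\<lambda>s. F (- s)) has_vector_derivative - f (- s)) (at s)" for s
      using vector_diff_chain_at[of uminus "- 1" s F "f (- s)"] F
      by (auto simp: o_def)
    from pos[OF this, of "- t"] 3 show ?thesis using bd[of "- _"] by simp
  qed
qed

text \<open>Writing the unknown as \<open>c u t = z + exp (K \<bar>t\<bar>) u t\<close> makes the Picard operator a contraction of the bounded
  continuous functions on the whole line, so that no local solutions have to be continued.\<close>

theorem lipschitz_ode_global_solution:
  fixes V :: "'a::euclidean_space \<Rightarrow> 'a"
  assumes lip: "L-lipschitz_on UNIV V" and bdd: "bounded (range V)"
  shows "\<exists>\<gamma>. \<gamma> 0 = z \<and> (\<forall>t. (\<gamma> has_vector_derivative V (\<gamma> t)) (at t))"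
proof -
  \<comment> \<open>The contraction factor will be L/K; this choice keeps it below 1/2 and K
    positive, also for L = 0.\<close>
  define K where "K = 2 * L + 1"
  have L: "0 \<le> L" using lip by (rule lipschitz_on_nonneg)
  have K: "0 < K" using L by (simp add: K_def)
  have lipV: "norm (V x - V y) \<le> L * norm (x - y)" for x y
    using lipschitz_onD[OF lip, of x y] by (simp add: dist_norm)
  have contV: "continuous_on S V" for S
    using lipschitz_on_continuous_on[OF lip] continuous_on_subset by blast
  obtain M where M: "\<And>x. norm (V x) \<le> M" using bdd by (auto simp: bounded_iff)
  have M0: "0 \<le> M" using M[of 0] norm_ge_zero order_trans by blast
  define c :: "(real \<Rightarrow>\<^sub>C 'a) \<Rightarrow> real \<Rightarrow> 'a" where "c = (\<lambda>u t. z + exp (K * \<bar>t\<bar>) *\<^sub>R u t)"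
  have contc: "continuous_on UNIV (c u)" for u
    unfolding c_def by (intro continuous_intros) auto
  have "\<exists>F. F 0 = 0 \<and> (\<forall>t. (F has_vector_derivative V (c u t)) (at t))" for u
  proof -
    have "continuous_on UNIV (\<lambda>t. V (c u t))"
      using contV contc by (rule continuous_on_compose2) auto
    hence "\<exists>F. \<forall>t. (F has_vector_derivative V (c u t)) (at t)"
      using einterval_antiderivative[of "-\<infinity>" "\<infinity>" "\<lambda>t. V (c u t)"]
      by (auto simp: continuous_on_eq_continuous_at)
    then obtain F where F: "\<And>t. (F has_vector_derivative V (c u t)) (at t)" by auto
    have "((\<lambda>t. F t - F 0) has_vector_derivative V (c u t)) (at t)" for t
      using has_vector_derivative_diff[OF F has_vector_derivative_const] by simp
    thus ?thesis by (intro exI[of _ "\<lambda>t. F t - F 0"]) auto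
  qed
  then obtain F where F0: "\<And>u. F u 0 = 0"
    and F: "\<And>u t. (F u has_vector_derivative V (c u t)) (at t)" by metis
  have Fc: "continuous_on UNIV (F u)" for u
    using F has_vector_derivative_continuous by (metis continuous_at_imp_continuous_on)
  \<comment> \<open>The Picard iterate in the rescaled unknown: T u = u says that c u equals z plus
    the antiderivative of V (c u) vanishing at 0.\<close>
  define T where "T u = Bcontfun (\<lambda>t. exp (- (K * \<bar>t\<bar>)) *\<^sub>R F u t)" for u
  have T: "apply_bcontfun (T u) = (\<lambda>t. exp (- (K * \<bar>t\<bar>)) *\<^sub>R F u t)" for u
    unfolding T_def
  proof (intro Bcontfun_inverse bcontfun_normI)
    fix t
    have "norm (F u t - F u 0) \<le> M / K * exp (K * \<bar>t\<bar>)"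
    proof (rule exp_weighted_increment_bound[OF F K M0])
      fix t
      have "M * 1 \<le> M * exp (K * \<bar>t\<bar>)" using M0 K by (intro mult_left_mono) auto
      thus "norm (V (c u t)) \<le> M * exp (K * \<bar>t\<bar>)" using M[of "c u t"] by simp
    qed
    thus "norm (exp (- (K * \<bar>t\<bar>)) *\<^sub>R F u t) \<le> M / K"
      by (simp add: F0 exp_minus field_simps)
  qed (intro continuous_intros Fc)
  have "\<exists>!u. T u = u"
  proof (rule banach_fix_type[of "L / K"])
    show "\<forall>u v. dist (T u) (T v) \<le> L / K * dist u v"
    proof (intro allI dist_bound)
      fix u v :: "real \<Rightarrow>\<^sub>C 'a" and t
      have "norm ((F u t - F v t) - (F u 0 - F v 0)) \<le> L * dist u v / K * exp (K * \<bar>t\<bar>)"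
      proof (rule exp_weighted_increment_bound[OF has_vector_derivative_diff[OF F F] K])
        fix t
        have "c u t - c v t = exp (K * \<bar>t\<bar>) *\<^sub>R (u t - v t)" by (simp add: c_def algebra_simps)
        hence "norm (c u t - c v t) = exp (K * \<bar>t\<bar>) * dist (u t) (v t)" by (simp add: dist_norm)
        also have "\<dots> \<le> exp (K * \<bar>t\<bar>) * dist u v" by (intro mult_left_mono dist_bounded) auto
        finally have "L * norm (c u t - c v t) \<le> L * (exp (K * \<bar>t\<bar>) * dist u v)"
          using L by (intro mult_left_mono)
        thus "norm (V (c u t) - V (c v t)) \<le> L * dist u v * exp (K * \<bar>t\<bar>)"
          using lipV[of "c u t" "c v t"] by (simp add: mult_ac)
      qed (use L in auto)
      hence "norm (F u t - F v t) \<le> L * dist u v / K * exp (K * \<bar>t\<bar>)" by (simp add: F0)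
      hence "exp (- (K * \<bar>t\<bar>)) * norm (F u t - F v t)
          \<le> exp (- (K * \<bar>t\<bar>)) * (L * dist u v / K * exp (K * \<bar>t\<bar>))"
        by (intro mult_left_mono) auto
      moreover have "dist (T u t) (T v t) = exp (- (K * \<bar>t\<bar>)) * norm (F u t - F v t)"
        by (simp add: T dist_norm scaleR_diff_right[symmetric])
      moreover have "exp (- (K * \<bar>t\<bar>)) * (r * exp (K * \<bar>t\<bar>)) = r" for r
        by (simp add: exp_minus)
      ultimately show "dist (T u t) (T v t) \<le> L / K * dist u v"
        by simp
    qed
  qed (use L K in \<open>auto simp: K_def\<close>)
  then obtain u where u: "T u = u" by auto
  have cu: "c u t = z + F u t" for t
  proof -
    have "u t = exp (- (K * \<bar>t\<bar>)) *\<^sub>R F u t" using T[of u] u by metis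
    thus ?thesis by (simp add: c_def exp_minus)
  qed
  have "c u 0 = z" using cu[of 0] F0 by simp
  moreover have "(c u has_vector_derivative V (c u t)) (at t)" for t
  proof -
    have "((\<lambda>t. z + F u t) has_vector_derivative 0 + V (c u t)) (at t)"
      by (intro has_vector_derivative_add has_vector_derivative_const F)
    moreover have "(\<lambda>t. z + F u t) = c u" using cu by auto
    ultimately show ?thesis by simp
  qed
  ultimately show ?thesis by blast
qed

text \<open>The squared distance d of two solutions satisfies |d'| <= 2 L d. Hence exp(-2 L t) d(t)
  does not increase and exp(2 L t) d(t) does not decrease; the first carries d(s) = 0 forward in
  time, the second backward.\<close>

theorem lipschitz_ode_unique:
  fixes V :: "'a::real_inner \<Rightarrow> 'a"
  assumes lip: "L-lipschitz_on UNIV V"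
    and x: "\<And>t. (x has_vector_derivative V (x t)) (at t)"
    and y: "\<And>t. (y has_vector_derivative V (y t)) (at t)"
    and eq: "x s = y s"
  shows "x = y"
proof
  fix t
  define d where "d t = (x t - y t) \<bullet> (x t - y t)" for t
  define d' where "d' t = 2 * ((x t - y t) \<bullet> (V (x t) - V (y t)))" for t
  have d: "(d has_real_derivative d' t) (at t)" for t
  proof -
    have "((\<lambda>t. x t - y t) has_derivative (\<lambda>h. h *\<^sub>R (V (x t) - V (y t)))) (at t)"
      using has_vector_derivative_diff[OF x y] by (simp add: has_vector_derivative_def)
    from has_derivative_inner[OF this this] show ?thesis
      unfolding d_def d'_def has_field_derivative_def
      by (rule has_derivative_eq_rhs) (auto simp: inner_commute algebra_simps)
  qed
  have bd: "\<bar>d' t\<bar> \<le> 2 * L * d t" for t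
  proof -
    have "\<bar>(x t - y t) \<bullet> (V (x t) - V (y t))\<bar> \<le> norm (x t - y t) * norm (V (x t) - V (y t))"
      by (rule Cauchy_Schwarz_ineq2)
    also have "\<dots> \<le> norm (x t - y t) * (L * norm (x t - y t))"
      using lipschitz_onD[OF lip, of "x t" "y t"] by (intro mult_left_mono) (auto simp: dist_norm)
    also have "\<dots> = L * d t" by (simp add: d_def power2_norm_eq_inner[symmetric] power2_eq_square)
    finally show ?thesis by (simp add: d'_def abs_mult)
  qed
  have "d t \<le> 0"
  proof (cases "s \<le> t")
    case True
    have "exp (- 2 * L * t) * d t \<le> exp (- 2 * L * s) * d s"
    proof (rule DERIV_nonpos_imp_nonincreasing[OF True], intro exI conjI)
      fix r
      show "((\<lambda>t. exp (- 2 * L * t) * d t) has_real_derivative exp (- 2 * L * r) * (d' r - 2 * L * d r)) (at r)"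
        by (auto intro!: derivative_eq_intros d simp: algebra_simps)
      show "exp (- 2 * L * r) * (d' r - 2 * L * d r) \<le> 0"
        using bd[of r] by (intro mult_nonneg_nonpos) auto
    qed
    thus ?thesis using eq by (simp add: d_def mult_le_0_iff)
  next
    case False
    hence "t \<le> s" by simp
    have "exp (2 * L * t) * d t \<le> exp (2 * L * s) * d s"
    proof (rule DERIV_nonneg_imp_nondecreasing[OF \<open>t \<le> s\<close>], intro exI conjI)
      fix r
      show "((\<lambda>t. exp (2 * L * t) * d t) has_real_derivative exp (2 * L * r) * (d' r + 2 * L * d r)) (at r)"
        by (auto intro!: derivative_eq_intros d simp: algebra_simps)
      show "exp (2 * L * r) * (d' r + 2 * L * d r) \<ge> 0"
        using bd[of r] by (intro mult_nonneg_nonneg) auto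
    qed
    thus ?thesis using eq by (simp add: d_def mult_le_0_iff)
  qed
  hence "d t = 0" using inner_ge_zero[of "x t - y t"] unfolding d_def by linarith
  thus "x t = y t" by (simp add: d_def)
qed

section \<open>Regular level curves of $p(x) - q(y)$\<close>

text \<open>Each coefficient costs a factor t. Half of the exponent absorbs it, and the other half
  is left to the induction hypothesis, which is why \<open>c\<close> varies in the
  induction.\<close>

lemma bounded_poly_times_gauss:
  fixes p :: "real poly"
  assumes "0 < c" shows "bounded (range (\<lambda>t. poly p t * exp (- (c * t\<^sup>2))))"
  using assms
proof (induction p arbitrary: c)
  case 0
  show ?case by simp
next
  case (pCons a p)
  have t: "\<bar>t\<bar> * exp (- (c / 2 * t\<^sup>2)) \<le> 1 + 2 / c" for t :: real
  proof -
    have "c / 2 * t\<^sup>2 \<le> exp (c / 2 * t\<^sup>2)" using exp_ge_add_one_self[of "c / 2 * t\<^sup>2"] by linarith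
    hence "2 / c * (c / 2 * t\<^sup>2) \<le> 2 / c * exp (c / 2 * t\<^sup>2)"
      using pCons.prems by (intro mult_left_mono) auto
    hence "t\<^sup>2 \<le> 2 / c * exp (c / 2 * t\<^sup>2)" using pCons.prems by simp
    moreover have "1 \<le> exp (c / 2 * t\<^sup>2)" using pCons.prems by simp
    moreover have "\<bar>t\<bar> \<le> 1 + t\<^sup>2"
      using zero_le_power2[of "\<bar>t\<bar> - 1"] by (simp add: power2_eq_square algebra_simps)
    ultimately have "\<bar>t\<bar> \<le> (1 + 2 / c) * exp (c / 2 * t\<^sup>2)"
      unfolding distrib_right mult_1 by linarith
    thus ?thesis by (simp add: exp_minus field_simps)
  qed
  obtain M where M: "\<And>t. \<bar>poly p t * exp (- (c / 2 * t\<^sup>2))\<bar> \<le> M"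
    using pCons.IH[of "c / 2"] pCons.prems by (auto simp: bounded_iff)
  have "\<bar>poly (pCons a p) t * exp (- (c * t\<^sup>2))\<bar> \<le> \<bar>a\<bar> + (1 + 2 / c) * M" for t
  proof -
    let ?E = "exp (- (c / 2 * t\<^sup>2))"
    have E: "exp (- (c * t\<^sup>2)) = ?E * ?E" by (simp add: exp_add[symmetric])
    have "poly (pCons a p) t * exp (- (c * t\<^sup>2)) = a * exp (- (c * t\<^sup>2)) + (t * ?E) * (poly p t * ?E)"
      unfolding E by (simp add: algebra_simps)
    also have "\<bar>\<dots>\<bar> \<le> \<bar>a * exp (- (c * t\<^sup>2))\<bar> + \<bar>(t * ?E) * (poly p t * ?E)\<bar>"
      by (rule abs_triangle_ineq)
    also have "\<bar>a * exp (- (c * t\<^sup>2))\<bar> \<le> \<bar>a\<bar>"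
      using pCons.prems by (simp add: abs_mult mult_left_le)
    also have "\<bar>(t * ?E) * (poly p t * ?E)\<bar> \<le> (1 + 2 / c) * M"
      unfolding abs_mult[of "t * ?E"] using t[of t] M[of t] pCons.prems
      by (intro mult_mono) (auto simp: abs_mult)
    finally show ?thesis by simp
  qed
  thus ?case by (auto simp: bounded_iff)
qed

text \<open>The derivative is again a polynomial, p' - 2 t p, times the same Gaussian, and is
  therefore bounded.\<close>

lemma poly_times_gauss_lipschitz:
  fixes p :: "real poly"
  obtains L where "L-lipschitz_on UNIV (\<lambda>t. poly p t * exp (- t\<^sup>2))"
proof -
  let ?q = "pderiv p - [:0, 2:] * p"
  obtain M where M: "\<And>t. \<bar>poly ?q t * exp (- (1 * t\<^sup>2))\<bar> \<le> M"
    using bounded_poly_times_gauss[of 1 ?q] by (auto simp: bounded_iff)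
  have "((\<lambda>t. poly p t * exp (- t\<^sup>2)) has_real_derivative poly ?q t * exp (- (1 * t\<^sup>2))) (at t)" for t
    by (auto intro!: derivative_eq_intros simp: algebra_simps)
  hence "norm (poly p x * exp (- x\<^sup>2) - poly p y * exp (- y\<^sup>2)) \<le> M * norm (x - y)" for x y
    using M by (intro field_differentiable_bound[of UNIV]) auto
  moreover have "0 \<le> M" using M[of 0] by linarith
  ultimately have "M-lipschitz_on UNIV (\<lambda>t. poly p t * exp (- t\<^sup>2))"
    by (intro lipschitz_onI) (auto simp: dist_norm)
  thus ?thesis by (rule that)
qed

lemma lipschitz_on_product_of_bounded:
  fixes f g :: "real \<Rightarrow> real"
  assumes f: "K-lipschitz_on UNIV f" "\<And>t. \<bar>f t\<bar> \<le> A"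
    and g: "L-lipschitz_on UNIV g" "\<And>t. \<bar>g t\<bar> \<le> B"
  shows "(A * L + B * K)-lipschitz_on UNIV (\<lambda>z. f (fst z) * g (snd z))"
proof (rule lipschitz_onI)
  have AB: "0 \<le> A" "0 \<le> B" using f(2)[of 0] g(2)[of 0] by auto
  have KL: "0 \<le> K" "0 \<le> L" using f(1) g(1) lipschitz_on_nonneg by auto
  show "0 \<le> A * L + B * K" using AB KL by simp
  fix z w :: "real \<times> real"
  have "f (fst z) * g (snd z) - f (fst w) * g (snd w)
      = f (fst z) * (g (snd z) - g (snd w)) + g (snd w) * (f (fst z) - f (fst w))"
    by (simp add: algebra_simps)
  also have "\<bar>\<dots>\<bar> \<le> \<bar>f (fst z)\<bar> * \<bar>g (snd z) - g (snd w)\<bar> + \<bar>g (snd w)\<bar> * \<bar>f (fst z) - f (fst w)\<bar>"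
    by (metis abs_mult abs_triangle_ineq)
  also have "\<dots> \<le> A * (L * dist z w) + B * (K * dist z w)"
  proof (intro add_mono mult_mono)
    have "\<bar>g (snd z) - g (snd w)\<bar> \<le> L * dist (snd z) (snd w)"
      using lipschitz_onD[OF g(1), of "snd z" "snd w"] by (simp add: dist_real_def)
    also have "\<dots> \<le> L * dist z w" using KL by (intro mult_left_mono dist_snd_le)
    finally show "\<bar>g (snd z) - g (snd w)\<bar> \<le> L * dist z w" .
    have "\<bar>f (fst z) - f (fst w)\<bar> \<le> K * dist (fst z) (fst w)"
      using lipschitz_onD[OF f(1), of "fst z" "fst w"] by (simp add: dist_real_def)
    also have "\<dots> \<le> K * dist z w" using KL by (intro mult_left_mono dist_fst_le)
    finally show "\<bar>f (fst z) - f (fst w)\<bar> \<le> K * dist z w" .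
  qed (use f g AB KL in auto)
  finally show "dist (f (fst z) * g (snd z)) (f (fst w) * g (snd w)) \<le> (A * L + B * K) * dist z w"
    by (simp add: dist_real_def algebra_simps)
qed

text \<open>The functions along a solution \<open>(x, y)\<close> of the damped field: closed under differentiation, hence
  smooth.\<close>

inductive_set gauss_algebra :: "(real \<Rightarrow> real) \<Rightarrow> (real \<Rightarrow> real) \<Rightarrow> (real \<Rightarrow> real) set" for x y where
  const: "(\<lambda>t. c) \<in> gauss_algebra x y"
| x: "x \<in> gauss_algebra x y"
| y: "y \<in> gauss_algebra x y"
| gauss: "(\<lambda>t. exp (- ((x t)\<^sup>2 + (y t)\<^sup>2))) \<in> gauss_algebra x y"
| add: "f \<in> gauss_algebra x y \<Longrightarrow> g \<in> gauss_algebra x y \<Longrightarrow> (\<lambda>t. f t + g t) \<in> gauss_algebra x y"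
| mult: "f \<in> gauss_algebra x y \<Longrightarrow> g \<in> gauss_algebra x y \<Longrightarrow> (\<lambda>t. f t * g t) \<in> gauss_algebra x y"

lemma gauss_algebra_poly:
  assumes "f \<in> gauss_algebra x y" shows "(\<lambda>t. poly r (f t)) \<in> gauss_algebra x y"
proof (induction r)
  case 0
  show ?case using gauss_algebra.const[of 0] by simp
next
  case (pCons a r)
  show ?case
    using gauss_algebra.add[OF gauss_algebra.const[of a] gauss_algebra.mult[OF assms pCons.IH]] by simp
qed

lemma gauss_algebra_derivative:
  assumes X: "X \<in> gauss_algebra x y" "\<And>t. (x has_real_derivative X t) (at t)"
    and Y: "Y \<in> gauss_algebra x y" "\<And>t. (y has_real_derivative Y t) (at t)"
    and f: "f \<in> gauss_algebra x y"
  shows "\<exists>f' \<in> gauss_algebra x y. \<forall>t. (f has_real_derivative f' t) (at t)"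
  using f
proof induction
  case (const c)
  show ?case by (rule bexI[OF _ gauss_algebra.const[of 0]]) auto
next
  case x
  show ?case using X by auto
next
  case y
  show ?case using Y by auto
next
  case gauss
  let ?E = "\<lambda>t. exp (- ((x t)\<^sup>2 + (y t)\<^sup>2))"
  have "(\<lambda>t. (- 2) * (x t * X t + y t * Y t) * ?E t) \<in> gauss_algebra x y"
    by (intro gauss_algebra.intros X Y)
  thus ?case
    by (rule rev_bexI) (auto intro!: derivative_eq_intros X Y simp: algebra_simps)
next
  case (add f g)
  then obtain f' g' where "f' \<in> gauss_algebra x y" "\<And>t. (f has_real_derivative f' t) (at t)"
    "g' \<in> gauss_algebra x y" "\<And>t. (g has_real_derivative g' t) (at t)" by blast
  thus ?case
    by (intro bexI[of _ "\<lambda>t. f' t + g' t"])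
       (auto intro!: derivative_eq_intros gauss_algebra.intros)
next
  case (mult f g)
  then obtain f' g' where "f' \<in> gauss_algebra x y" "\<And>t. (f has_real_derivative f' t) (at t)"
    "g' \<in> gauss_algebra x y" "\<And>t. (g has_real_derivative g' t) (at t)" by blast
  thus ?case using mult.hyps
    by (intro bexI[of _ "\<lambda>t. f' t * g t + f t * g' t"])
       (auto intro!: derivative_eq_intros gauss_algebra.intros)
qed

section \<open>Smoothness of orbits and local covering of the level set\<close>

lemma regular_parametrization_pair:
  fixes x y :: "real \<Rightarrow> real"
  assumes K: "x \<in> K" "y \<in> K" "\<And>f. f \<in> K \<Longrightarrow> \<exists>f' \<in> K. \<forall>t. (f has_real_derivative f' t) (at t)"
    and nz: "\<And>t. deriv x t \<noteq> 0 \<or> deriv y t \<noteq> 0"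
  shows "regular_parametrization (\<lambda>t. (x t, y t))"
proof -
  have step: "deriv f \<in> K \<and> (\<forall>t. (f has_real_derivative deriv f t) (at t))" if "f \<in> K" for f
  proof -
    from K(3)[OF that] obtain f' where f': "f' \<in> K" "\<And>t. (f has_real_derivative f' t) (at t)" by blast
    hence "deriv f = f'" by (auto intro: DERIV_imp_deriv)
    thus ?thesis using f' by simp
  qed
  have mem: "(deriv ^^ k) f \<in> K" if "f \<in> K" for k f
    by (induction k) (use that step in auto)
  define D where "D k t = ((deriv ^^ k) x t, (deriv ^^ k) y t)" for k t
  have "(D k has_vector_derivative D (Suc k) t) (at t)" for k t
  proof -
    have "((deriv ^^ k) f has_vector_derivative (deriv ^^ Suc k) f t) (at t)" if "f \<in> K" for f
      using step[OF mem[OF that, of k]] by (simp add: has_real_derivative_iff_has_vector_derivative)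
    from has_vector_derivative_Pair[OF this[OF K(1)] this[OF K(2)]]
    show ?thesis by (simp add: D_def[abs_def])
  qed
  moreover have "D 0 = (\<lambda>t. (x t, y t))" by (simp add: D_def[abs_def])
  moreover have "D 1 t \<noteq> 0" for t using nz[of t] by (auto simp: D_def zero_prod_def)
  ultimately show ?thesis unfolding regular_parametrization_def by blast
qed

text \<open>Supplies parameters near t between which x sweeps a neighbourhood of x(t).\<close>

lemma nonzero_derivative_both_sides:
  fixes x :: "real \<Rightarrow> real"
  assumes "(x has_real_derivative l) (at t)" "l \<noteq> 0" "0 < \<eta>"
  shows "\<exists>r s. \<bar>r - t\<bar> < \<eta> \<and> \<bar>s - t\<bar> < \<eta> \<and> x r < x t \<and> x t < x s"
proof -
  have *: "\<exists>r s. \<bar>r - t\<bar> < \<eta> \<and> \<bar>s - t\<bar> < \<eta> \<and> x r < x t \<and> x t < x s"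
    if der: "(x has_real_derivative l) (at t)" "0 < l" for x l
  proof -
    from DERIV_pos_inc_right[OF der] DERIV_pos_inc_left[OF der]
    obtain d d' where d: "0 < d" "\<And>h. 0 < h \<Longrightarrow> h < d \<Longrightarrow> x t < x (t + h)"
      and d': "0 < d'" "\<And>h. 0 < h \<Longrightarrow> h < d' \<Longrightarrow> x (t - h) < x t" by blast
    define h where "h = min \<eta> (min d d') / 2"
    have "0 < h" "h < \<eta>" "h < d" "h < d'" using d d' assms(3) by (auto simp: h_def min_def)
    thus ?thesis using d d' by (intro exI[of _ "t - h"] exI[of _ "t + h"]) auto
  qed
  show ?thesis
  proof (cases "0 < l")
    case True
    thus ?thesis using * assms by blast
  next
    case False
    have "\<exists>r s. \<bar>r - t\<bar> < \<eta> \<and> \<bar>s - t\<bar> < \<eta> \<and> - x r < - x t \<and> - x t < - x s"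
      using *[OF DERIV_minus[OF assms(1)]] False assms(2) by auto
    thus ?thesis by auto
  qed
qed

text \<open>A local implicit function argument: a point (u, v) of the level set near the curve has u
  = x(w) by the intermediate value theorem, and then g(y(w)) = f(u) = g(v) gives y(w) = v by
  injectivity.\<close>

lemma curve_covers_level_set_locally:
  fixes x y f g :: "real \<Rightarrow> real"
  assumes x: "(x has_real_derivative l) (at t)" "l \<noteq> 0"
    and cont: "continuous_on UNIV x" "continuous_on UNIV y"
    and inj: "inj_on g (ball (y t) \<epsilon>)" "0 < \<epsilon>" and lev: "\<And>t. f (x t) = g (y t)" and "0 < \<eta>"
  shows "\<exists>d>0. \<forall>u v. \<bar>u - x t\<bar> < d \<and> \<bar>v - y t\<bar> < d \<and> f u = g v \<longrightarrow>
    (\<exists>s. \<bar>s - t\<bar> < \<eta> \<and> x s = u \<and> y s = v)"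
proof -
  have "isCont y t" using cont by (simp add: continuous_on_eq_continuous_at)
  then obtain \<eta>1 where \<eta>1: "0 < \<eta>1" "\<And>s. \<bar>s - t\<bar> < \<eta>1 \<Longrightarrow> \<bar>y s - y t\<bar> < \<epsilon>"
    using inj(2) unfolding continuous_at_eps_delta dist_real_def by blast
  define \<eta>2 where "\<eta>2 = min \<eta> \<eta>1"
  have \<eta>2: "0 < \<eta>2" using assms \<eta>1 by (simp add: \<eta>2_def)
  obtain r s where rs: "\<bar>r - t\<bar> < \<eta>2" "\<bar>s - t\<bar> < \<eta>2" "x r < x t" "x t < x s"
    using nonzero_derivative_both_sides[OF x \<eta>2] by blast
  have con: "connected (x ` ball t \<eta>2)"
    by (intro connected_continuous_image continuous_on_subset[OF cont(1)]) auto
  define d where "d = min \<epsilon> (min (x t - x r) (x s - x t))"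
  have "0 < d" using rs inj by (simp add: d_def)
  moreover have "\<exists>s. \<bar>s - t\<bar> < \<eta> \<and> x s = u \<and> y s = v"
    if uv: "\<bar>u - x t\<bar> < d" "\<bar>v - y t\<bar> < d" "f u = g v" for u v
  proof -
    have "x r \<in> x ` ball t \<eta>2" "x s \<in> x ` ball t \<eta>2"
      using rs by (auto simp: dist_real_def abs_minus_commute)
    moreover have "x r \<le> u" "u \<le> x s" using uv by (auto simp: d_def abs_less_iff)
    ultimately have "u \<in> x ` ball t \<eta>2" using connectedD_interval[OF con] by blast
    then obtain w where w: "u = x w" "\<bar>w - t\<bar> < \<eta>2"
      by (auto simp: dist_real_def abs_minus_commute)
    have "g (y w) = g v" using lev[of w] uv w by simp
    moreover have "y w \<in> ball (y t) \<epsilon>" "v \<in> ball (y t) \<epsilon>"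
      using \<eta>1(2)[of w] w uv by (auto simp: dist_real_def abs_minus_commute \<eta>2_def d_def)
    ultimately have "y w = v" using inj(1) by (auto dest: inj_onD)
    thus ?thesis using w by (auto simp: \<eta>2_def)
  qed
  ultimately show ?thesis by blast
qed

lemma poly_locally_strict_monotone:
  fixes q :: "real poly"
  assumes "poly (pderiv q) y \<noteq> 0"
  shows "\<exists>\<epsilon>>0. (\<forall>u \<in> ball y \<epsilon>. \<forall>v \<in> ball y \<epsilon>. u < v \<longrightarrow> poly q u < poly q v) \<or>
               (\<forall>u \<in> ball y \<epsilon>. \<forall>v \<in> ball y \<epsilon>. u < v \<longrightarrow> poly q v < poly q u)"
proof -
  have *: "\<exists>\<epsilon>>0. \<forall>u \<in> ball y \<epsilon>. \<forall>v \<in> ball y \<epsilon>. u < v \<longrightarrow> poly q u < poly q v"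
    if "0 < poly (pderiv q) y" for q :: "real poly"
  proof -
    have "open {t. 0 < poly (pderiv q) t}" by (intro open_Collect_less continuous_intros)
    moreover have "y \<in> {t. 0 < poly (pderiv q) t}" using that by simp
    ultimately obtain \<epsilon> where \<epsilon>: "0 < \<epsilon>" "ball y \<epsilon> \<subseteq> {t. 0 < poly (pderiv q) t}"
      by (rule openE)
    have "poly q u < poly q v" if "u \<in> ball y \<epsilon>" "v \<in> ball y \<epsilon>" "u < v" for u v
    proof (rule DERIV_pos_imp_increasing[OF that(3)])
      fix t assume "u \<le> t" "t \<le> v"
      hence "t \<in> ball y \<epsilon>" using that by (auto simp: dist_real_def abs_less_iff)
      thus "\<exists>y. (poly q has_real_derivative y) (at t) \<and> 0 < y" using \<epsilon> poly_DERIV by blast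
    qed
    thus ?thesis using \<epsilon> by blast
  qed
  show ?thesis
  proof (cases "0 < poly (pderiv q) y")
    case True
    thus ?thesis using * by blast
  next
    case False
    hence "0 < poly (pderiv (- q)) y" using assms by (simp add: pderiv_minus)
    from *[OF this] show ?thesis by auto
  qed
qed

section \<open>Connectedness of the two sides of the curve\<close>

text \<open>Let S be split into open sets U and V. Their closures cover Z, and no point of Z lies in
  both, as S is connected near that point. Since Z is connected, it misses one of the closures, say
  that of U; then U is open and closed in the whole space, which is absurd.\<close>

lemma connected_if_locally_connected_along_boundary:
  fixes S Z :: "'a::real_normed_vector set"
  assumes S: "open S" "S \<noteq> UNIV" and Z: "connected Z" "Z \<subseteq> closure S" "closure S \<subseteq> S \<union> Z"
    and loc: "\<And>z. z \<in> Z \<Longrightarrow> \<exists>W. open W \<and> z \<in> W \<and> connected (S \<inter> W)"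
  shows "connected S"
proof (rule ccontr)
  assume "\<not> connected S"
  then obtain A B where AB: "open A" "open B" "S \<subseteq> A \<union> B" "A \<inter> B \<inter> S = {}" "A \<inter> S \<noteq> {}" "B \<inter> S \<noteq> {}"
    unfolding connected_def by blast
  have key: False
    if UV: "open U" "open V" "U \<union> V = S" "U \<inter> V = {}" "U \<noteq> {}" "V \<noteq> {}" "closure U \<inter> Z = {}" for U V
  proof -
    have "closure U \<subseteq> S" using UV(3,7) Z(3) closure_mono[of U S] by blast
    moreover have "closure U \<inter> V = {}"
      using UV(2,4) open_Int_closure_eq_empty[of V U] by (simp add: Int_commute)
    ultimately have "closure U \<subseteq> U" using UV(3) by blast
    hence "closed U" using closure_subset[of U] closure_eq[of U] by simp
    hence "U = UNIV" using UV(1,5) clopen[of U] by blast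
    thus False using UV(4,6) by simp
  qed
  let ?U = "A \<inter> S" and ?V = "B \<inter> S"
  have UV: "open ?U" "open ?V" "?U \<union> ?V = S" "?U \<inter> ?V = {}" using AB S by auto
  have "closure ?U \<inter> closure ?V \<inter> Z = {}"
  proof (rule ccontr)
    assume "\<not> ?thesis"
    then obtain z where z: "z \<in> Z" "z \<in> closure ?U" "z \<in> closure ?V" by blast
    then obtain W where W: "open W" "z \<in> W" "connected (S \<inter> W)" using loc by blast
    have "W \<inter> ?U \<noteq> {}" "W \<inter> ?V \<noteq> {}"
      using z W(2) open_Int_closure_eq_empty[OF W(1)] by blast+
    moreover have "?U \<inter> (S \<inter> W) = {} \<or> ?V \<inter> (S \<inter> W) = {}"
      by (rule connectedD[OF W(3) UV(1,2)]) (use AB(3,4) in blast)+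
    ultimately show False by blast
  qed
  moreover have "Z \<subseteq> closure ?U \<union> closure ?V" using Z(2) UV(3) closure_Un[of ?U ?V] by simp
  ultimately have "closure ?U \<inter> Z = {} \<or> closure ?V \<inter> Z = {}"
    by (rule connected_closedD[OF Z(1)]) auto
  thus False
  proof
    assume "closure ?U \<inter> Z = {}"
    thus False by (rule key[OF UV AB(5,6)])
  next
    assume "closure ?V \<inter> Z = {}"
    moreover have "?V \<union> ?U = S" "?V \<inter> ?U = {}" using UV(3,4) by blast+
    ultimately show False using key[OF UV(2,1) _ _ AB(6,5)] by blast
  qed
qed

text \<open>W is a comb: the horizontal slice at height \<open>c\<close> is its spine and the
  vertical fibres are the teeth.\<close>

lemma connected_fibred_over_interval:
  fixes W :: "(real \<times> real) set"
  assumes I: "connected I" and base: "\<And>x. x \<in> I \<Longrightarrow> (x, c) \<in> W"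
    and W: "\<And>x y. (x, y) \<in> W \<Longrightarrow> x \<in> I"
    and fib: "\<And>x. x \<in> I \<Longrightarrow> connected {y. (x, y) \<in> W}"
  shows "connected W"
proof (cases "I = {}")
  case True
  hence "W = {}" using W by auto
  thus ?thesis by simp
next
  case False
  let ?H = "(\<lambda>x. (x, c)) ` I"
  let ?F = "\<lambda>x. Pair x ` {y. (x, y) \<in> W}"
  have H: "connected ?H" by (intro connected_continuous_image continuous_intros I)
  have F: "connected (?F x)" if "x \<in> I" for x
    using fib[OF that] by (intro connected_continuous_image continuous_intros)
  have "connected (\<Union> ((\<lambda>x. ?H \<union> ?F x) ` I))"
  proof (rule connected_Union)
    show "connected s" if "s \<in> (\<lambda>x. ?H \<union> ?F x) ` I" for s
      using that H F base by (auto intro!: connected_Un)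
    show "\<Inter> ((\<lambda>x. ?H \<union> ?F x) ` I) \<noteq> {}" using False by auto
  qed
  also have "\<Union> ((\<lambda>x. ?H \<union> ?F x) ` I) = W"
  proof (intro equalityI subsetI)
    fix z assume "z \<in> W"
    thus "z \<in> \<Union> ((\<lambda>x. ?H \<union> ?F x) ` I)"
      using W by (intro UN_I[of "fst z"]) (cases z; auto)+
  next
    fix z assume "z \<in> \<Union> ((\<lambda>x. ?H \<union> ?F x) ` I)"
    thus "z \<in> W" using base by blast
  qed
  finally show ?thesis .
qed

text \<open>A height \<open>c\<close> just above or below y0, according to the direction of g, lies
  on the side f < g for all x near x0. In a small box the vertical fibres of the side are intervals
  by monotonicity of g, and all of them contain \<open>c\<close>.\<close>

lemma level_side_locally_connected:
  fixes f g :: "real \<Rightarrow> real"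
  assumes f: "continuous_on UNIV f" and eq: "f x0 = g y0" and \<epsilon>: "0 < \<epsilon>"
    and mono: "(\<forall>u \<in> ball y0 \<epsilon>. \<forall>v \<in> ball y0 \<epsilon>. u < v \<longrightarrow> g u < g v) \<or>
               (\<forall>u \<in> ball y0 \<epsilon>. \<forall>v \<in> ball y0 \<epsilon>. u < v \<longrightarrow> g v < g u)"
  shows "(\<exists>W. open W \<and> (x0, y0) \<in> W \<and> connected ({(x, y). f x < g y} \<inter> W)) \<and>
    (x0, y0) \<in> closure {(x, y). f x < g y}"
proof -
  have near: "\<exists>c. \<bar>c - y0\<bar> < e \<and> c \<in> ball y0 \<epsilon> \<and> f x0 < g c" if "0 < e" for e
  proof -
    define k where "k = min e \<epsilon> / 2"
    have "0 < k" "k < e" "k < \<epsilon>" using that \<epsilon> by (auto simp: k_def)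
    hence k: "0 < k" "\<bar>(y0 + k) - y0\<bar> < e" "\<bar>(y0 - k) - y0\<bar> < e"
      and ball: "y0 \<in> ball y0 \<epsilon>" "y0 + k \<in> ball y0 \<epsilon>" "y0 - k \<in> ball y0 \<epsilon>"
      by (auto simp: dist_real_def)
    from mono have "g y0 < g (y0 + k) \<or> g y0 < g (y0 - k)"
    proof
      assume "\<forall>u \<in> ball y0 \<epsilon>. \<forall>v \<in> ball y0 \<epsilon>. u < v \<longrightarrow> g u < g v"
      from this[rule_format, OF ball(1,2)] k(1) show ?thesis by simp
    next
      assume "\<forall>u \<in> ball y0 \<epsilon>. \<forall>v \<in> ball y0 \<epsilon>. u < v \<longrightarrow> g v < g u"
      from this[rule_format, OF ball(3,1)] k(1) show ?thesis by simp
    qed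
    thus ?thesis unfolding eq using k(2,3) ball(2,3) by blast
  qed
  obtain c where c: "c \<in> ball y0 \<epsilon>" "f x0 < g c" using near[OF \<epsilon>] by blast
  have "open {x. f x < g c}" using f by (intro open_Collect_less continuous_intros)
  moreover have "x0 \<in> {x. f x < g c}" using c by simp
  ultimately obtain \<delta> where \<delta>: "0 < \<delta>" "ball x0 \<delta> \<subseteq> {x. f x < g c}"
    by (rule openE)
  define W where "W = ball x0 \<delta> \<times> ball y0 \<epsilon>"
  have "connected ({(x, y). f x < g y} \<inter> W)"
  proof (rule connected_fibred_over_interval[of "ball x0 \<delta>" c])
    fix x assume "x \<in> ball x0 \<delta>"
    hence "{y. (x, y) \<in> {(x, y). f x < g y} \<inter> W} = {y \<in> ball y0 \<epsilon>. f x < g y}"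
      by (auto simp: W_def)
    moreover have "is_interval {y \<in> ball y0 \<epsilon>. f x < g y}"
      unfolding is_interval_1
    proof safe
      fix a b m assume ab: "a \<in> ball y0 \<epsilon>" "b \<in> ball y0 \<epsilon>" "f x < g a" "f x < g b" "a \<le> m" "m \<le> b"
      show m: "m \<in> ball y0 \<epsilon>" using ab by (auto simp: dist_real_def abs_less_iff)
      show "f x < g m"
      proof (cases "a = m \<or> m = b")
        case True
        thus ?thesis using ab by auto
      next
        case False
        hence "a < m" "m < b" using ab by auto
        from mono show ?thesis
        proof
          assume "\<forall>u \<in> ball y0 \<epsilon>. \<forall>v \<in> ball y0 \<epsilon>. u < v \<longrightarrow> g u < g v"
          hence "g a < g m" using ab(1) m \<open>a < m\<close> by blast
          thus ?thesis using ab(3) by simp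
        next
          assume "\<forall>u \<in> ball y0 \<epsilon>. \<forall>v \<in> ball y0 \<epsilon>. u < v \<longrightarrow> g v < g u"
          hence "g b < g m" using ab(2) m \<open>m < b\<close> by blast
          thus ?thesis using ab(4) by simp
        qed
      qed
    qed
    ultimately show "connected {y. (x, y) \<in> {(x, y). f x < g y} \<inter> W}"
      using is_interval_connected by metis
  qed (use c \<delta> in \<open>auto simp: W_def\<close>)
  moreover have "open W" "(x0, y0) \<in> W" using \<delta> \<epsilon> by (auto simp: W_def intro: open_Times)
  moreover have "(x0, y0) \<in> closure {(x, y). f x < g y}"
    unfolding closure_approachable
  proof safe
    fix e :: real assume "0 < e"
    from near[OF this] obtain c where "\<bar>c - y0\<bar> < e" "f x0 < g c" by blast
    thus "\<exists>z \<in> {(x, y). f x < g y}. dist z (x0, y0) < e"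
      by (intro bexI[of _ "(x0, c)"]) (auto simp: dist_Pair_Pair dist_real_def)
  qed
  ultimately show ?thesis by blast
qed

lemma lipschitz_on_pair:
  fixes f :: "'a::metric_space \<Rightarrow> real" and g :: "'a \<Rightarrow> real"
  assumes "K-lipschitz_on UNIV f" "L-lipschitz_on UNIV g"
  shows "(K + L)-lipschitz_on UNIV (\<lambda>z. (f z, g z))"
proof (rule lipschitz_onI)
  show "0 \<le> K + L" using assms lipschitz_on_nonneg by (metis add_nonneg_nonneg)
  fix z w
  have "dist (f z, g z) (f w, g w) \<le> dist (f z) (f w) + dist (g z) (g w)"
    unfolding dist_Pair_Pair by (rule sqrt_sum_squares_le_sum) auto
  also have "\<dots> \<le> K * dist z w + L * dist z w"
    using assms by (intro add_mono lipschitz_onD) auto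
  finally show "dist (f z, g z) (f w, g w) \<le> (K + L) * dist z w" by (simp add: algebra_simps)
qed

section \<open>The orbit of the damped Hamiltonian field\<close>

text \<open>The assumption says that the gradient of p(x) - q(y) does not vanish on the curve. With
  two polynomials the locale is stable under (p, q) -> (-p, -q), which exchanges the two sides of
  the curve.\<close>

locale separable_curve =
  fixes p q :: "real poly"
  assumes regular: "\<And>x y. poly p x = poly q y \<Longrightarrow> poly (pderiv p) x \<noteq> 0 \<or> poly (pderiv q) y \<noteq> 0"
begin

definition Z :: "(real \<times> real) set" where "Z = {(x, y). poly p x = poly q y}"

text \<open>Without the Gaussian factor this is (q'(y), p'(x)), along which p(x) - q(y) is constant;
  the factor changes only the speed.\<close>

definition V :: "real \<times> real \<Rightarrow> real \<times> real" where
  "V = (\<lambda>(x, y). (poly (pderiv q) y * exp (- (x\<^sup>2 + y\<^sup>2)), poly (pderiv p) x * exp (- (x\<^sup>2 + y\<^sup>2))))"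

text \<open>Each component is a product of one function of x and one of y. The factor
  \<open>poly 1\<close> brings the bare Gaussian into the form covered by the one-variable
  estimates.\<close>

lemma V_alt:
  "V = (\<lambda>z. ((poly 1 (fst z) * exp (- (fst z)\<^sup>2)) * (poly (pderiv q) (snd z) * exp (- (snd z)\<^sup>2)),
             (poly (pderiv p) (fst z) * exp (- (fst z)\<^sup>2)) * (poly 1 (snd z) * exp (- (snd z)\<^sup>2))))"
proof -
  have "exp (- (x\<^sup>2 + y\<^sup>2)) = exp (- x\<^sup>2) * exp (- y\<^sup>2)" for x y :: real
    by (simp add: exp_add[symmetric])
  thus ?thesis by (auto simp: V_def mult_ac)
qed

lemma V_lipschitz: "\<exists>L. L-lipschitz_on UNIV V"
  and V_bounded: "bounded (range V)"
proof -
  have bd: "\<exists>M. \<forall>t. \<bar>poly r t * exp (- t\<^sup>2)\<bar> \<le> M" for r :: "real poly"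
    using bounded_poly_times_gauss[of 1 r] by (auto simp: bounded_iff)
  obtain A where A: "\<And>t. \<bar>poly (pderiv p) t * exp (- t\<^sup>2)\<bar> \<le> A" using bd by blast
  obtain B where B: "\<And>t. \<bar>poly (pderiv q) t * exp (- t\<^sup>2)\<bar> \<le> B" using bd by blast
  obtain C where C: "\<And>t :: real. \<bar>poly 1 t * exp (- t\<^sup>2)\<bar> \<le> C" using bd[of 1] by blast
  obtain a where a: "a-lipschitz_on UNIV (\<lambda>t. poly (pderiv p) t * exp (- t\<^sup>2))"
    by (rule poly_times_gauss_lipschitz)
  obtain b where b: "b-lipschitz_on UNIV (\<lambda>t. poly (pderiv q) t * exp (- t\<^sup>2))"
    by (rule poly_times_gauss_lipschitz)
  obtain c where c: "c-lipschitz_on UNIV (\<lambda>t :: real. poly 1 t * exp (- t\<^sup>2))"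
    by (rule poly_times_gauss_lipschitz)
  from lipschitz_on_pair[OF lipschitz_on_product_of_bounded[OF c C b B]
      lipschitz_on_product_of_bounded[OF a A c C]]
  show "\<exists>L. L-lipschitz_on UNIV V" unfolding V_alt by blast
  have AC: "0 \<le> A" "0 \<le> C" using A[of 0] C[of 0] by linarith+
  have "norm (V z) \<le> C * B + A * C" for z
  proof -
    have "norm (V z) \<le> norm (fst (V z)) + norm (snd (V z))"
      using norm_Pair_le[of "fst (V z)" "snd (V z)"] by simp
    also have "norm (fst (V z)) \<le> C * B"
      unfolding V_alt fst_conv real_norm_def abs_mult[of "poly 1 (fst z) * exp (- (fst z)\<^sup>2)"]
      by (intro mult_mono C B AC abs_ge_zero)
    also have "norm (snd (V z)) \<le> A * C"
      unfolding V_alt snd_conv real_norm_def abs_mult[of "poly (pderiv p) (fst z) * exp (- (fst z)\<^sup>2)"]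
      by (intro mult_mono A C AC abs_ge_zero)
    finally show ?thesis by simp
  qed
  thus "bounded (range V)" by (auto simp: bounded_iff)
qed

definition solution :: "(real \<Rightarrow> real \<times> real) \<Rightarrow> bool" where
  "solution \<gamma> \<longleftrightarrow> (\<forall>t. (\<gamma> has_vector_derivative V (\<gamma> t)) (at t))"

lemma solution_exists: "\<exists>\<gamma>. solution \<gamma> \<and> \<gamma> 0 = z"
  using V_lipschitz V_bounded lipschitz_ode_global_solution unfolding solution_def by blast

lemma solution_unique: "solution \<gamma> \<Longrightarrow> solution \<gamma>' \<Longrightarrow> \<gamma> s = \<gamma>' s \<Longrightarrow> \<gamma> = \<gamma>'"
  using V_lipschitz lipschitz_ode_unique unfolding solution_def by blast

lemma solution_shift: "solution \<gamma> \<Longrightarrow> solution (\<lambda>t. \<gamma> (t + s))"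
  unfolding solution_def
proof
  fix t assume "\<forall>t. (\<gamma> has_vector_derivative V (\<gamma> t)) (at t)"
  moreover have "((\<lambda>t. t + s) has_vector_derivative 1) (at t)"
    by (auto intro!: derivative_eq_intros simp: has_real_derivative_iff_has_vector_derivative[symmetric])
  ultimately show "((\<lambda>t. \<gamma> (t + s)) has_vector_derivative V (\<gamma> (t + s))) (at t)"
    using vector_diff_chain_at[of "\<lambda>t. t + s" 1 t \<gamma>] by (auto simp: o_def)
qed

lemma solution_derivs:
  assumes "solution \<gamma>"
  shows "((\<lambda>t. fst (\<gamma> t)) has_real_derivative
      poly (pderiv q) (snd (\<gamma> t)) * exp (- ((fst (\<gamma> t))\<^sup>2 + (snd (\<gamma> t))\<^sup>2))) (at t)"
    and "((\<lambda>t. snd (\<gamma> t)) has_real_derivative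
      poly (pderiv p) (fst (\<gamma> t)) * exp (- ((fst (\<gamma> t))\<^sup>2 + (snd (\<gamma> t))\<^sup>2))) (at t)"
proof -
  have "(\<gamma> has_vector_derivative V (\<gamma> t)) (at t)" using assms by (simp add: solution_def)
  from bounded_linear.has_vector_derivative[OF bounded_linear_fst this]
    bounded_linear.has_vector_derivative[OF bounded_linear_snd this]
  show "((\<lambda>t. fst (\<gamma> t)) has_real_derivative
      poly (pderiv q) (snd (\<gamma> t)) * exp (- ((fst (\<gamma> t))\<^sup>2 + (snd (\<gamma> t))\<^sup>2))) (at t)"
    "((\<lambda>t. snd (\<gamma> t)) has_real_derivative
      poly (pderiv p) (fst (\<gamma> t)) * exp (- ((fst (\<gamma> t))\<^sup>2 + (snd (\<gamma> t))\<^sup>2))) (at t)"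
    by (auto simp: V_def has_real_derivative_iff_has_vector_derivative split_beta)
qed

lemma solution_continuous: "solution \<gamma> \<Longrightarrow> continuous_on S \<gamma>"
  unfolding solution_def
  by (metis has_vector_derivative_continuous continuous_at_imp_continuous_on)

lemma solution_in_Z:
  assumes "solution \<gamma>" "\<gamma> s \<in> Z" shows "\<gamma> t \<in> Z"
proof -
  have "((\<lambda>t. poly p (fst (\<gamma> t)) - poly q (snd (\<gamma> t))) has_real_derivative 0) (at t)" for t
    by (auto intro!: derivative_eq_intros DERIV_chain2[OF poly_DERIV] solution_derivs[OF assms(1)])
  from DERIV_isconst_all[of "\<lambda>t. poly p (fst (\<gamma> t)) - poly q (snd (\<gamma> t))", rule_format, OF this, of t s]
  show ?thesis using assms(2) by (auto simp: Z_def split_beta)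
qed

text \<open>If q'(y) is nonzero, then at once x moves with nonzero speed and q is injective near y;
  otherwise p'(x) is nonzero and the coordinates exchange roles.\<close>

lemma solution_covers_locally:
  assumes sol: "solution \<gamma>" and Z: "\<gamma> t \<in> Z" and "0 < \<eta>"
  shows "\<exists>d>0. \<forall>z \<in> Z. dist z (\<gamma> t) < d \<longrightarrow> (\<exists>s. \<bar>s - t\<bar> < \<eta> \<and> \<gamma> s = z)"
proof -
  let ?x = "\<lambda>t. fst (\<gamma> t)" and ?y = "\<lambda>t. snd (\<gamma> t)"
  have lev: "poly p (?x s) = poly q (?y s)" for s
    using solution_in_Z[OF sol Z, of s] by (auto simp: Z_def split_beta)
  have cont: "continuous_on UNIV ?x" "continuous_on UNIV ?y"
    by (intro continuous_intros solution_continuous[OF sol])+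
  have inj: "\<exists>\<epsilon>>0. inj_on (poly r) (ball c \<epsilon>)" if "poly (pderiv r) c \<noteq> 0" for r :: "real poly" and c
  proof -
    from poly_locally_strict_monotone[OF that] obtain \<epsilon> where \<epsilon>: "0 < \<epsilon>"
      "(\<forall>u \<in> ball c \<epsilon>. \<forall>v \<in> ball c \<epsilon>. u < v \<longrightarrow> poly r u < poly r v) \<or>
       (\<forall>u \<in> ball c \<epsilon>. \<forall>v \<in> ball c \<epsilon>. u < v \<longrightarrow> poly r v < poly r u)" by blast
    hence "inj_on (poly r) (ball c \<epsilon>)"
      by (intro linorder_inj_onI) (fastforce, rule linear)
    thus ?thesis using \<epsilon> by blast
  qed
  have "\<exists>d>0. \<forall>u v. \<bar>u - ?x t\<bar> < d \<and> \<bar>v - ?y t\<bar> < d \<and> poly p u = poly q v \<longrightarrow>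
      (\<exists>s. \<bar>s - t\<bar> < \<eta> \<and> ?x s = u \<and> ?y s = v)"
  proof (cases "poly (pderiv q) (?y t) = 0")
    case False
    from inj[OF this] obtain \<epsilon> where \<epsilon>: "0 < \<epsilon>" "inj_on (poly q) (ball (?y t) \<epsilon>)" by blast
    show ?thesis
      by (rule curve_covers_level_set_locally[OF solution_derivs(1)[OF sol] _ cont \<epsilon>(2,1)])
         (use False lev assms in auto)
  next
    case True
    hence nz: "poly (pderiv p) (?x t) \<noteq> 0" using regular lev by blast
    from inj[OF this] obtain \<epsilon> where \<epsilon>: "0 < \<epsilon>" "inj_on (poly p) (ball (?x t) \<epsilon>)" by blast
    have "\<exists>d>0. \<forall>v u. \<bar>v - ?y t\<bar> < d \<and> \<bar>u - ?x t\<bar> < d \<and> poly q v = poly p u \<longrightarrow>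
        (\<exists>s. \<bar>s - t\<bar> < \<eta> \<and> ?y s = v \<and> ?x s = u)"
      by (rule curve_covers_level_set_locally[OF solution_derivs(2)[OF sol] _ cont(2,1) \<epsilon>(2,1)])
         (use nz lev assms in auto)
    thus ?thesis by metis
  qed
  then obtain d where d: "0 < d" "\<And>u v. \<bar>u - ?x t\<bar> < d \<Longrightarrow> \<bar>v - ?y t\<bar> < d \<Longrightarrow> poly p u = poly q v \<Longrightarrow>
      \<exists>s. \<bar>s - t\<bar> < \<eta> \<and> ?x s = u \<and> ?y s = v" by blast
  have "\<exists>s. \<bar>s - t\<bar> < \<eta> \<and> \<gamma> s = z" if "z \<in> Z" "dist z (\<gamma> t) < d" for z
  proof -
    have "\<bar>fst z - ?x t\<bar> < d" "\<bar>snd z - ?y t\<bar> < d"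
      using dist_fst_le[of z "\<gamma> t"] dist_snd_le[of z "\<gamma> t"] that by (auto simp: dist_real_def)
    thus ?thesis using d(2)[of "fst z" "snd z"] that by (auto simp: Z_def prod_eq_iff)
  qed
  thus ?thesis using d(1) by blast
qed

text \<open>Serves two ends: with U the whole line every orbit is open in Z, and for general U the
  inverse of an injective parametrization is continuous.\<close>

lemma solution_open_map:
  assumes sol: "solution \<gamma>" and Z: "\<gamma> 0 \<in> Z" and U: "open U"
  shows "openin (top_of_set Z) (\<gamma> ` U)"
  unfolding openin_euclidean_subtopology_iff
proof (intro conjI ballI)
  show "\<gamma> ` U \<subseteq> Z" using solution_in_Z[OF sol Z] by blast
  fix w assume "w \<in> \<gamma> ` U"
  then obtain t where t: "w = \<gamma> t" "t \<in> U" by blast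
  then obtain \<eta> where \<eta>: "0 < \<eta>" "ball t \<eta> \<subseteq> U" using U open_contains_ball by blast
  from solution_covers_locally[OF sol solution_in_Z[OF sol Z] \<eta>(1), of t]
  obtain d where d: "0 < d" "\<And>z. z \<in> Z \<Longrightarrow> dist z (\<gamma> t) < d \<Longrightarrow> \<exists>s. \<bar>s - t\<bar> < \<eta> \<and> \<gamma> s = z" by blast
  show "\<exists>e>0. \<forall>x'\<in>Z. dist x' w < e \<longrightarrow> x' \<in> \<gamma> ` U"
  proof (intro exI[of _ d] conjI ballI impI d(1))
    fix z assume "z \<in> Z" "dist z w < d"
    then obtain s where "\<bar>s - t\<bar> < \<eta>" "\<gamma> s = z" using d t by blast
    moreover from this have "s \<in> U" using \<eta> by (auto simp: dist_real_def abs_minus_commute)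
    ultimately show "z \<in> \<gamma> ` U" by blast
  qed
qed

text \<open>Lying on a common orbit is an equivalence relation, by time shifts and uniqueness, and
  its classes in Z are relatively open; a connected Z is a single class.\<close>

lemma solution_range:
  assumes sol: "solution \<gamma>" and Z: "\<gamma> 0 \<in> Z" and conn: "connected Z"
  shows "range \<gamma> = Z"
proof
  show "range \<gamma> \<subseteq> Z" using solution_in_Z[OF sol Z] by blast
  define R where "R a b \<longleftrightarrow> (\<exists>\<delta> s. solution \<delta> \<and> \<delta> 0 = a \<and> \<delta> s = b)" for a b
  have R: "R (\<gamma> 0) z" if "z \<in> Z" for z
  proof (rule connected_equivalence_relation[OF conn Z that])
    show "R b a" if "R a b" for a b
    proof -
      from that obtain \<delta> s where \<delta>: "solution \<delta>" "\<delta> 0 = a" "\<delta> s = b" by (auto simp: R_def)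
      thus ?thesis unfolding R_def
        by (intro exI[of _ "\<lambda>t. \<delta> (t + s)"] exI[of _ "- s"]) (auto intro: solution_shift)
    qed
    show "R a c" if "R a b" "R b c" for a b c
    proof -
      from that obtain \<delta> s \<delta>' s' where \<delta>: "solution \<delta>" "\<delta> 0 = a" "\<delta> s = b"
        and \<delta>': "solution \<delta>'" "\<delta>' 0 = b" "\<delta>' s' = c" by (auto simp: R_def)
      have "(\<lambda>t. \<delta> (t + s)) = \<delta>'"
        by (rule solution_unique[OF solution_shift[OF \<delta>(1)] \<delta>'(1), of 0]) (use \<delta> \<delta>' in auto)
      hence "\<delta> (s' + s) = c" using \<delta>'(3) fun_cong[of "\<lambda>t. \<delta> (t + s)" \<delta>' s'] by simp
      thus ?thesis using \<delta>(1,2) unfolding R_def by blast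
    qed
    fix a assume a: "a \<in> Z"
    obtain \<delta> where \<delta>: "solution \<delta>" "\<delta> 0 = a" using solution_exists by blast
    have "openin (top_of_set Z) (range \<delta>)" using solution_open_map[OF \<delta>(1)] \<delta> a by simp
    thus "\<exists>T. openin (top_of_set Z) T \<and> a \<in> T \<and> (\<forall>x\<in>T. R a x)"
      using \<delta> unfolding R_def by (intro exI[of _ "range \<delta>"]) blast
  qed
  show "Z \<subseteq> range \<gamma>"
  proof
    fix z assume "z \<in> Z"
    then obtain \<delta> s where \<delta>: "solution \<delta>" "\<delta> 0 = \<gamma> 0" "\<delta> s = z" using R unfolding R_def by blast
    have "\<delta> = \<gamma>" by (rule solution_unique[OF \<delta>(1) sol \<delta>(2)])
    thus "z \<in> range \<gamma>" using \<delta>(3) by blast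
  qed
qed

text \<open>By uniqueness a single return makes the solution periodic, so its range is the image of
  the compact interval [0, T]. On an unbounded curve this yields injectivity.\<close>

lemma solution_periodic_imp_bounded:
  assumes sol: "solution \<gamma>" and eq: "\<gamma> s = \<gamma> (s + T)" "0 < T"
  shows "bounded (range \<gamma>)"
proof -
  have "\<gamma> = (\<lambda>t. \<gamma> (t + T))"
    by (rule solution_unique[OF sol solution_shift[OF sol], of s]) (rule eq)
  hence per: "\<gamma> (t + T) = \<gamma> t" for t by metis
  have pern: "\<gamma> (t + real n * T) = \<gamma> t" for t n
  proof (induction n)
    case (Suc n)
    have "\<gamma> (t + real (Suc n) * T) = \<gamma> ((t + real n * T) + T)" by (simp add: algebra_simps)
    thus ?case using per Suc by simp
  qed simp
  have "range \<gamma> \<subseteq> \<gamma> ` {0..T}"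
  proof (rule image_subsetI)
    fix t
    define k where "k = \<lfloor>t / T\<rfloor>"
    define u where "u = t - of_int k * T"
    have u: "0 \<le> u" "u \<le> T"
      using eq(2) floor_divide_lower[OF eq(2), of t] floor_divide_upper[OF eq(2), of t]
      by (auto simp: u_def k_def algebra_simps)
    \<comment> \<open>\<open>pern\<close> shifts by natural multiples of \<open>T\<close> only: for
      k >= 0 it leads from u to t, for k < 0 from t to u.\<close>
    have "\<gamma> u = \<gamma> t"
    proof (cases "0 \<le> k")
      case True
      thus ?thesis using pern[of u "nat k"] by (simp add: u_def)
    next
      case False
      thus ?thesis using pern[of t "nat (- k)"] by (simp add: u_def)
    qed
    thus "\<gamma> t \<in> \<gamma> ` {0..T}" using u by (metis atLeastAtMost_iff image_eqI)
  qed
  moreover have "bounded (\<gamma> ` {0..T})"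
    by (intro compact_imp_bounded compact_continuous_image solution_continuous[OF sol]) auto
  ultimately show ?thesis using bounded_subset by blast
qed

lemma simple_regular_curve_Z:
  assumes conn: "connected Z" and unb: "\<not> bounded Z"
  shows "simple_regular_curve Z"
proof -
  from unb obtain z where z: "z \<in> Z" by (metis bounded_empty equals0I)
  obtain \<gamma> where sol: "solution \<gamma>" and "\<gamma> 0 = z" using solution_exists by blast
  hence Z0: "\<gamma> 0 \<in> Z" using z by simp
  have range: "range \<gamma> = Z" by (rule solution_range[OF sol Z0 conn])
  have inj: "inj \<gamma>"
  proof (rule linorder_injI)
    fix s t :: real assume "s < t"
    thus "\<gamma> s \<noteq> \<gamma> t"
      using solution_periodic_imp_bounded[OF sol, of s "t - s"] range unb by auto
  qed
  have "\<exists>h. homeomorphism UNIV Z \<gamma> h"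
    by (rule homeomorphism_injective_open_map[OF solution_continuous[OF sol] range inj])
       (use solution_open_map[OF sol Z0] in auto)
  moreover have "regular_parametrization \<gamma>"
  proof -
    let ?x = "\<lambda>t. fst (\<gamma> t)" and ?y = "\<lambda>t. snd (\<gamma> t)"
    let ?E = "\<lambda>t. exp (- ((?x t)\<^sup>2 + (?y t)\<^sup>2))"
    have X: "(\<lambda>t. poly (pderiv q) (?y t) * ?E t) \<in> gauss_algebra ?x ?y"
      by (intro gauss_algebra.mult gauss_algebra_poly gauss_algebra.y gauss_algebra.gauss)
    have Y: "(\<lambda>t. poly (pderiv p) (?x t) * ?E t) \<in> gauss_algebra ?x ?y"
      by (intro gauss_algebra.mult gauss_algebra_poly gauss_algebra.x gauss_algebra.gauss)
    have "regular_parametrization (\<lambda>t. (?x t, ?y t))"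
    proof (rule regular_parametrization_pair[OF gauss_algebra.x gauss_algebra.y])
      show "\<exists>f' \<in> gauss_algebra ?x ?y. \<forall>t. (f has_real_derivative f' t) (at t)"
        if "f \<in> gauss_algebra ?x ?y" for f
        by (rule gauss_algebra_derivative[OF X solution_derivs(1)[OF sol] Y solution_derivs(2)[OF sol] that])
      fix t
      have "poly p (?x t) = poly q (?y t)"
        using solution_in_Z[OF sol Z0, of t] by (auto simp: Z_def split_beta)
      from regular[OF this] show "deriv ?x t \<noteq> 0 \<or> deriv ?y t \<noteq> 0"
        using DERIV_imp_deriv[OF solution_derivs(1)[OF sol, of t]]
          DERIV_imp_deriv[OF solution_derivs(2)[OF sol, of t]] by auto
    qed
    thus ?thesis by simp
  qed
  ultimately show ?thesis unfolding simple_regular_curve_def by blast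
qed

lemma side_locally_connected:
  assumes "poly p x = poly q y"
  shows "(\<exists>W. open W \<and> (x, y) \<in> W \<and> connected ({(x, y). poly p x < poly q y} \<inter> W)) \<and>
    (x, y) \<in> closure {(x, y). poly p x < poly q y}"
proof (cases "poly (pderiv q) y = 0")
  case False
  from poly_locally_strict_monotone[OF this] obtain \<epsilon> where "0 < \<epsilon>"
    "(\<forall>u \<in> ball y \<epsilon>. \<forall>v \<in> ball y \<epsilon>. u < v \<longrightarrow> poly q u < poly q v) \<or>
     (\<forall>u \<in> ball y \<epsilon>. \<forall>v \<in> ball y \<epsilon>. u < v \<longrightarrow> poly q v < poly q u)" by blast
  thus ?thesis
    by (intro level_side_locally_connected[of "poly p" x "poly q" y, OF _ assms] continuous_intros)
next
  case True
  \<comment> \<open>Written as -q(y) < -p(x), the side has -p as its locally monotone function, and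
    the local result applies with exchanged coordinates.\<close>
  hence "poly (pderiv (- p)) x \<noteq> 0" using regular[OF assms] by (simp add: pderiv_minus)
  from poly_locally_strict_monotone[OF this] obtain \<epsilon> where \<epsilon>: "0 < \<epsilon>"
    "(\<forall>u \<in> ball x \<epsilon>. \<forall>v \<in> ball x \<epsilon>. u < v \<longrightarrow> poly (- p) u < poly (- p) v) \<or>
     (\<forall>u \<in> ball x \<epsilon>. \<forall>v \<in> ball x \<epsilon>. u < v \<longrightarrow> poly (- p) v < poly (- p) u)" by blast
  have eq: "poly (- q) y = poly (- p) x" using assms by simp
  have *: "(\<exists>W. open W \<and> (y, x) \<in> W \<and> connected ({(y, x). poly (- q) y < poly (- p) x} \<inter> W)) \<and>
    (y, x) \<in> closure {(y, x). poly (- q) y < poly (- p) x}"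
    by (intro level_side_locally_connected[of "poly (- q)" y "poly (- p)" x, OF _ eq \<epsilon>] continuous_intros)
  have swap: "prod.swap ` {(y, x). poly (- q) y < poly (- p) x} = {(x, y). poly p x < poly q y}"
    by (auto intro!: image_eqI[of _ _ "(_, _)"])
  from * obtain W where W: "open W" "(y, x) \<in> W"
    "connected ({(y, x). poly (- q) y < poly (- p) x} \<inter> W)" by blast
  have "connected (prod.swap ` ({(y, x). poly (- q) y < poly (- p) x} \<inter> W))"
    by (intro connected_continuous_image continuous_on_swap W)
  also have "prod.swap ` ({(y, x). poly (- q) y < poly (- p) x} \<inter> W)
      = {(x, y). poly p x < poly q y} \<inter> prod.swap -` W"
    by (auto intro!: image_eqI[of _ _ "(_, _)"])
  finally have "connected ({(x, y). poly p x < poly q y} \<inter> prod.swap -` W)" .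
  moreover have "open (prod.swap -` W)"
    using W(1) continuous_on_swap by (intro open_vimage) auto
  moreover have "(x, y) \<in> closure {(x, y). poly p x < poly q y}"
  proof -
    have "prod.swap (y, x) \<in> closure (prod.swap ` {(y, x). poly (- q) y < poly (- p) x})"
      by (rule subsetD[OF image_closure_subset[OF continuous_on_swap closed_closure closure_subset]])
         (use * in blast)
    thus ?thesis unfolding swap by simp
  qed
  moreover have "(x, y) \<in> prod.swap -` W" using W(2) by simp
  ultimately show ?thesis by blast
qed

lemma open_side: "open {(x, y). poly p x < poly q y}"
proof -
  have "open {z :: real \<times> real. poly p (fst z) < poly q (snd z)}"
    by (intro open_Collect_less continuous_intros)
  thus ?thesis by (simp add: case_prod_unfold)
qed

lemma side_connected:
  assumes conn: "connected Z" and ne: "Z \<noteq> {}"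
  shows "connected {(x, y). poly p x < poly q y}" "{(x, y). poly p x < poly q y} \<noteq> {}"
proof -
  let ?S = "{(x, y). poly p x < poly q y}"
  have Zc: "Z \<subseteq> closure ?S" using side_locally_connected by (auto simp: Z_def)
  thus "?S \<noteq> {}" using ne by (metis closure_empty subset_empty)
  show "connected ?S"
  proof (rule connected_if_locally_connected_along_boundary[OF open_side _ conn Zc])
    from ne obtain z where "z \<in> Z" by blast
    hence "z \<notin> ?S" by (auto simp: Z_def)
    thus "?S \<noteq> UNIV" by blast
    have "closed {z :: real \<times> real. poly p (fst z) \<le> poly q (snd z)}"
      by (intro closed_Collect_le continuous_intros)
    hence "closure ?S \<subseteq> {z. poly p (fst z) \<le> poly q (snd z)}"
      by (intro closure_minimal) auto
    thus "closure ?S \<subseteq> ?S \<union> Z" by (force simp: Z_def)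
    show "\<exists>W. open W \<and> z \<in> W \<and> connected (?S \<inter> W)" if "z \<in> Z" for z
      using side_locally_connected that by (auto simp: Z_def)
  qed
qed

lemma card_components_complement_Z:
  assumes conn: "connected Z" and ne: "Z \<noteq> {}"
  shows "card (components (UNIV - Z)) = 2"
proof -
  interpret neg: separable_curve "- p" "- q"
    by unfold_locales (use regular in \<open>auto simp: pderiv_minus\<close>)
  have Zneg: "neg.Z = Z" by (auto simp: Z_def neg.Z_def)
  let ?S = "{(x, y). poly p x < poly q y}" and ?T = "{(x, y). poly q y < poly p x}"
  have T: "{(x, y). poly (- p) x < poly (- q) y} = ?T" by simp
  note S = side_connected[OF assms] open_side
  note T = neg.side_connected[unfolded Zneg T, OF assms] neg.open_side[unfolded T]
  have un: "UNIV - Z = ?S \<union> ?T" by (auto simp: Z_def)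
  have dis: "?S \<inter> ?T = {}" by auto
  have sub: "C = ?S \<or> C = ?T" if C: "C \<in> components (UNIV - Z)" for C
  proof -
    have CC: "connected C" "C \<subseteq> ?S \<union> ?T" "C \<noteq> {}"
      using in_components_connected[OF C] in_components_subset[OF C] in_components_nonempty[OF C]
      unfolding un by blast+
    have "?S \<inter> C = {} \<or> ?T \<inter> C = {}"
      using connectedD[OF CC(1) S(3) T(3)] dis CC(2) by blast
    hence "C \<subseteq> ?S \<or> C \<subseteq> ?T" using CC(2) by blast
    thus ?thesis
    proof
      assume "C \<subseteq> ?S"
      hence "?S \<subseteq> C" using components_maximal[OF C S(1)] un CC(3) by blast
      thus ?thesis using \<open>C \<subseteq> ?S\<close> by blast
    next
      assume "C \<subseteq> ?T"
      hence "?T \<subseteq> C" using components_maximal[OF C T(1)] un CC(3) by blast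
      thus ?thesis using \<open>C \<subseteq> ?T\<close> by blast
    qed
  qed
  have "?S \<in> components (UNIV - Z)"
  proof -
    obtain z where z: "z \<in> ?S" using S(2) by blast
    then obtain C where "C \<in> components (UNIV - Z)" "z \<in> C"
      using Union_components[of "UNIV - Z"] un by blast
    thus ?thesis using sub[of C] z dis by blast
  qed
  moreover have "?T \<in> components (UNIV - Z)"
  proof -
    obtain z where z: "z \<in> ?T" using T(2) by blast
    then obtain C where "C \<in> components (UNIV - Z)" "z \<in> C"
      using Union_components[of "UNIV - Z"] un by blast
    thus ?thesis using sub[of C] z dis by blast
  qed
  ultimately have "components (UNIV - Z) = {?S, ?T}" using sub by blast
  moreover have "?S \<noteq> ?T" using S(2) dis by blast
  ultimately show ?thesis by simp
qed

end

section \<open>Hermite polynomials\<close>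

fun hermite_poly :: "nat \<Rightarrow> real poly" where
  "hermite_poly 0 = 1"
| "hermite_poly (Suc 0) = [:0, 2:]"
| "hermite_poly (Suc (Suc n))
     = [:0, 2:] * hermite_poly (Suc n) - smult (2 * real (Suc n)) (hermite_poly n)"

lemma hermite_eq_poly: "hermite n t = poly (hermite_poly n) t"
  by (induction n t rule: hermite.induct) (auto simp: algebra_simps)

lemma degree_hermite_poly: "degree (hermite_poly n) = n"
proof -
  have "degree (hermite_poly n) = n \<and> degree (hermite_poly (Suc n)) = Suc n"
  proof (induction n)
    case (Suc n)
    let ?p = "[:0, 2:] * hermite_poly (Suc n)"
    let ?q = "smult (2 * real (Suc n)) (hermite_poly n)"
    have "hermite_poly (Suc n) \<noteq> 0" using Suc by auto
    hence p: "degree ?p = Suc (Suc n)" using Suc by (subst degree_mult_eq) auto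
    moreover have "degree ?q \<le> n" using Suc degree_smult_le[of _ "hermite_poly n"] by metis
    ultimately have "degree (?p + - ?q) = Suc (Suc n)"
      by (subst degree_add_eq_left) auto
    thus ?case using Suc by simp
  qed auto
  thus ?thesis by simp
qed

lemma hermite_minus: "hermite n (- t) = (-1) ^ n * hermite n t"
  by (induction n t rule: hermite.induct) (auto simp: algebra_simps)

text \<open>At 0 the recursion loses its first term: H_{n+2}(0) = -2 (n+1) H_n(0).\<close>

lemma hermite_0_nonzero: "even n \<Longrightarrow> hermite n 0 \<noteq> 0"
proof (induction n "0::real" rule: hermite.induct)
  case (3 n)
  thus ?case by (auto simp: even_Suc)
qed auto

text \<open>Both formulas go through one induction, because differentiating the recursion for
  H_{n+2} takes the derivatives of H_{n+1} and of H_n.\<close>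

lemma hermite_has_derivs:
  "(hermite n has_real_derivative 2 * t * hermite n t - hermite (Suc n) t) (at t)
   \<and> (hermite (Suc n) has_real_derivative 2 * real (Suc n) * hermite n t) (at t)"
proof (induction n arbitrary: t)
  case 0
  have eq: "hermite 0 = (\<lambda>t. 1)" "hermite (Suc 0) = (\<lambda>t. 2 * t)" by auto
  show ?case unfolding eq by (auto intro!: derivative_eq_intros)
next
  case (Suc n)
  have eq: "hermite (Suc (Suc n)) = (\<lambda>t. 2 * t * hermite (Suc n) t - 2 * real (Suc n) * hermite n t)"
    by auto
  have 1: "(hermite n has_real_derivative 2 * t * hermite n t - hermite (Suc n) t) (at t)" for t
    using Suc by blast
  have 2: "(hermite (Suc n) has_real_derivative 2 * real (Suc n) * hermite n t) (at t)" for t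
    using Suc by blast
  have "(hermite (Suc (Suc n)) has_real_derivative 2 * real (Suc (Suc n)) * hermite (Suc n) t) (at t)"
    unfolding eq by (auto intro!: derivative_eq_intros 1 2 simp: algebra_simps)
  moreover have 3: "2 * real (Suc n) * hermite n t = 2 * t * hermite (Suc n) t - hermite (Suc (Suc n)) t"
    by simp
  ultimately show ?case using 2[of t, unfolded 3] by blast
qed


lemma hermite_like_hermite:
  assumes "even m"
  shows "hermite_like (hermite (Suc m)) (hermite m) (2 * real (Suc m))"
proof
  show "hermite (Suc m) (- t) = - hermite (Suc m) t" "hermite m (- t) = hermite m t" for t
    using assms by (simp_all add: hermite_minus del: hermite.simps)
  have "hermite_poly m \<noteq> 0"
    using hermite_0_nonzero[OF assms] by (auto simp: hermite_eq_poly)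
  thus "finite {t. hermite m t = 0}"
    by (simp add: hermite_eq_poly poly_roots_finite)
  show "(hermite (Suc m) has_real_derivative 2 * real (Suc m) * hermite m t) (at t)"
    "(hermite m has_real_derivative 2 * t * hermite m t - hermite (Suc m) t) (at t)" for t
    using hermite_has_derivs[of m t] by blast+
qed (use hermite_0_nonzero[OF assms] in simp_all)

lemma hermite_abs_at_top: "filterlim (\<lambda>t. \<bar>hermite (Suc m) t\<bar>) at_top at_top"
proof -
  have "filterlim (poly (hermite_poly (Suc m))) at_infinity at_infinity"
    by (rule filterlim_poly_at_infinity) (simp add: degree_hermite_poly)
  hence "filterlim (hermite (Suc m)) at_infinity at_top"
    unfolding hermite_eq_poly[abs_def] by (rule filterlim_mono) (simp_all add: at_top_le_at_infinity)
  from filterlim_at_infinity_imp_norm_at_top[OF this] show ?thesis by (simp only: real_norm_def)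
qed

lemma hermite_level_curve:
  assumes "even m"
  shows "\<exists>a. 0 < a \<and> a < 1 \<and> (\<forall>b. a < \<bar>b\<bar> \<and> \<bar>b\<bar> < 1 / a \<and> \<bar>b\<bar> \<noteq> 1 \<longrightarrow>
    connected (level_curve (hermite (Suc m)) b) \<and> simple_regular_curve (level_curve (hermite (Suc m)) b) \<and>
    card (components (UNIV - level_curve (hermite (Suc m)) b)) = 2)"
proof -
  let ?h = "hermite (Suc m)"
  let ?p = "hermite_poly (Suc m)"
  interpret hermite_like ?h "hermite m" "2 * real (Suc m)"
    by (rule hermite_like_hermite[OF assms])
  obtain a where a: "0 < a" "a < 1" and conn: "\<And>b. a < \<bar>b\<bar> \<Longrightarrow> \<bar>b\<bar> < 1 / a \<Longrightarrow> \<bar>b\<bar> \<noteq> 1 \<Longrightarrow> connected (level_curve ?h b)"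
    and reg: "\<And>b x y. a < \<bar>b\<bar> \<Longrightarrow> \<bar>b\<bar> < 1 / a \<Longrightarrow> \<bar>b\<bar> \<noteq> 1 \<Longrightarrow> ?h x = b * ?h y \<Longrightarrow> hermite m x \<noteq> 0 \<or> hermite m y \<noteq> 0"
    using level_curve_connected_and_regular[OF hermite_abs_at_top] by blast
  have hp: "?h = poly ?p" by (rule ext) (rule hermite_eq_poly)
  have pd: "poly (pderiv ?p) t = 2 * real (Suc m) * hermite m t" for t
    by (rule DERIV_unique[OF poly_DERIV]) (use h[of t] in \<open>simp only: hp\<close>)
  have "connected (level_curve ?h b) \<and> simple_regular_curve (level_curve ?h b) \<and>
      card (components (UNIV - level_curve ?h b)) = 2"
    if b: "a < \<bar>b\<bar>" "\<bar>b\<bar> < 1 / a" "\<bar>b\<bar> \<noteq> 1" for b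
  proof -
    have b0: "b \<noteq> 0" using b a by auto
    interpret c: separable_curve ?p "smult b ?p"
    proof
      fix x y assume "poly ?p x = poly (smult b ?p) y"
      thus "poly (pderiv ?p) x \<noteq> 0 \<or> poly (pderiv (smult b ?p)) y \<noteq> 0"
        using reg[OF b, of x y] b0 by (simp add: pd pderiv_smult hp)
    qed
    have Z: "c.Z = level_curve ?h b" by (simp add: c.Z_def level_curve_def hp)
    have unb: "\<not> bounded (level_curve ?h b)"
    proof
      assume "bounded (level_curve ?h b)"
      then obtain B where B: "\<And>z. z \<in> level_curve ?h b \<Longrightarrow> norm z \<le> B" by (auto simp: bounded_iff)
      \<comment> \<open>The curve has a point at every height y, so it is unbounded.\<close>
      obtain x where "?h x = b * ?h (\<bar>B\<bar> + 1)" using surjective[OF hermite_abs_at_top] by blast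
      hence "norm (x, \<bar>B\<bar> + 1) \<le> B" by (intro B) (simp add: level_curve_def)
      moreover have "\<bar>B\<bar> + 1 \<le> norm (x, \<bar>B\<bar> + 1)"
        using norm_snd_le[of "\<bar>B\<bar> + 1" x] by simp
      ultimately show False by simp
    qed
    have "connected (level_curve ?h b)" using conn b by blast
    moreover from this have "simple_regular_curve (level_curve ?h b)"
      using c.simple_regular_curve_Z[unfolded Z] unb by blast
    moreover have "level_curve ?h b \<noteq> {}" using unb by auto
    ultimately show ?thesis using c.card_components_complement_Z[unfolded Z] by blast
  qed
  thus ?thesis using a by blast
qed

section \<open>From the angle to the level curve\<close>

text \<open>The exponential factor has no zeros, and the zero set is already closed, so taking the
  closure changes nothing.\<close>

lemma nodal_set_Phi:
  assumes "cos \<theta> \<noteq> 0"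
  shows "nodal_set (Phi n \<theta>) = level_curve (hermite n) (- tan \<theta>)"
proof -
  have "Phi n \<theta> (x, y) = 0 \<longleftrightarrow> cos \<theta> * hermite n x + sin \<theta> * hermite n y = 0" for x y
    by (simp add: Phi_def)
  moreover have "cos \<theta> * hermite n x + sin \<theta> * hermite n y = 0 \<longleftrightarrow> hermite n x = - tan \<theta> * hermite n y" for x y
    using assms by (auto simp: tan_def field_simps)
  ultimately have "{z. Phi n \<theta> z = 0} = level_curve (hermite n) (- tan \<theta>)"
    by (auto simp: level_curve_def)
  moreover have "closed (level_curve (hermite n) (- tan \<theta>))"
  proof -
    have "closed {z. poly (hermite_poly n) (fst z) = - tan \<theta> * poly (hermite_poly n) (snd z)}"
      by (intro closed_Collect_eq continuous_intros)
    thus ?thesis by (simp add: level_curve_def hermite_eq_poly case_prod_unfold)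
  qed
  ultimately show ?thesis by (simp add: nodal_set_def)
qed

theorem theorem1p3:
  fixes n :: nat
  assumes "odd n"
  shows "\<exists>a b c d :: real.
           pi / 4 \<in> {a<..<b} \<and> {a<..<b} \<subseteq> {0..<pi} \<and>
           3 * pi / 4 \<in> {c<..<d} \<and> {c<..<d} \<subseteq> {0..<pi} \<and>
           (\<forall>\<theta> \<in> ({a<..<b} \<union> {c<..<d}) - {pi / 4, 3 * pi / 4}.
              connected (nodal_set (Phi n \<theta>)) \<and>
              simple_regular_curve (nodal_set (Phi n \<theta>)) \<and>
              card (nodal_domains (Phi n \<theta>)) = 2)"
proof -
  obtain m where m: "n = Suc m" "even m" using assms by (cases n) simp_all
  obtain a where a: "0 < a" "a < 1"
    and main: "\<And>b. a < \<bar>b\<bar> \<Longrightarrow> \<bar>b\<bar> < 1 / a \<Longrightarrow> \<bar>b\<bar> \<noteq> 1 \<Longrightarrow>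
      connected (level_curve (hermite n) b) \<and> simple_regular_curve (level_curve (hermite n) b) \<and>
      card (components (UNIV - level_curve (hermite n) b)) = 2"
    using hermite_level_curve[OF m(2)] m(1) by blast
  \<comment> \<open>The angles at which tan reaches the bounds a and 1/a of the admissible factors.
    The interval around 3 pi/4 is the mirror image under theta -> pi - theta, which changes the sign
    of tan.\<close>
  define \<alpha> \<beta> where "\<alpha> = arctan a" and "\<beta> = arctan (1 / a)"
  have \<alpha>: "0 < \<alpha>" "\<alpha> < pi / 4" "pi / 4 < \<beta>" "\<beta> < pi / 2"
    using a arctan_less_iff[of a 1] arctan_less_iff[of 1 "1 / a"] arctan_ubound[of "1 / a"]
    by (simp_all add: \<alpha>_def \<beta>_def arctan_one)
  \<comment> \<open>\<open>\<phi>\<close> stands for theta on the first interval and for pi - theta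
    on the second, so only |tan theta| matters.\<close>
  have goal: "connected (nodal_set (Phi n \<theta>)) \<and> simple_regular_curve (nodal_set (Phi n \<theta>)) \<and>
      card (nodal_domains (Phi n \<theta>)) = 2"
    if \<phi>: "\<alpha> < \<phi>" "\<phi> < \<beta>" "\<phi> \<noteq> pi / 4" and tan: "\<bar>tan \<theta>\<bar> = tan \<phi>" and cos: "cos \<theta> \<noteq> 0" for \<theta> \<phi>
  proof -
    have arc: "arctan (tan \<phi>) = \<phi>" using \<phi> \<alpha> by (intro arctan_tan) auto
    have "a < tan \<phi>" using \<phi>(1) arc arctan_less_iff[of a "tan \<phi>"] by (simp add: \<alpha>_def)
    moreover have "tan \<phi> < 1 / a" using \<phi>(2) arc arctan_less_iff[of "tan \<phi>" "1 / a"] by (simp add: \<beta>_def)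
    moreover have "tan \<phi> \<noteq> 1" using \<phi>(3) arc arctan_one by auto
    ultimately show ?thesis
      using main[of "- tan \<theta>"] by (simp add: nodal_domains_def nodal_set_Phi[OF cos] tan)
  qed
  have "connected (nodal_set (Phi n \<theta>)) \<and> simple_regular_curve (nodal_set (Phi n \<theta>)) \<and>
      card (nodal_domains (Phi n \<theta>)) = 2"
    if \<theta>: "\<theta> \<in> ({\<alpha><..<\<beta>} \<union> {pi - \<beta><..<pi - \<alpha>}) - {pi / 4, 3 * pi / 4}" for \<theta>
  proof (cases "\<theta> \<in> {\<alpha><..<\<beta>}")
    case True
    show ?thesis
    proof (rule goal)
      show "\<bar>tan \<theta>\<bar> = tan \<theta>" using True \<alpha> tan_gt_zero[of \<theta>] by simp
      show "cos \<theta> \<noteq> 0" using True \<alpha> cos_gt_zero[of \<theta>] by simp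
    qed (use True \<theta> in auto)
  next
    case False
    hence \<phi>: "\<alpha> < pi - \<theta>" "pi - \<theta> < \<beta>" "pi - \<theta> \<noteq> pi / 4" using \<theta> by auto
    have "tan (pi - \<theta>) = - tan \<theta>" by (simp add: tan_def)
    moreover have "0 < tan (pi - \<theta>)" using \<phi> \<alpha> by (intro tan_gt_zero) auto
    ultimately have "\<bar>tan \<theta>\<bar> = tan (pi - \<theta>)" by simp
    moreover have "cos \<theta> \<noteq> 0" using cos_gt_zero[of "pi - \<theta>"] \<phi> \<alpha> by simp
    ultimately show ?thesis using goal[OF \<phi>] by blast
  qed
  moreover have "pi / 4 \<in> {\<alpha><..<\<beta>}" "{\<alpha><..<\<beta>} \<subseteq> {0..<pi}"
    "3 * pi / 4 \<in> {pi - \<beta><..<pi - \<alpha>}" "{pi - \<beta><..<pi - \<alpha>} \<subseteq> {0..<pi}"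
    using \<alpha> by auto
  ultimately show ?thesis by blast
qed

end
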